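(* Let $d\ge 2$ be an integer and let $p\in(1,\infty)$. For every constant $C_1>0$ there exists a constant $C_2>0$ (depending only on $d$, $p$ and $C_1$) such that for every integer $N\ge 1$ and every set $\mathcal P_N\subset[0,1]^d$ of exactly $N$ points whose discrepancy function $D_N$ satisfies $$\|D_N\|_p\le C_1(\log N)^{(d-1)/2},$$ one has $$\|D_N\|_1\ge C_2(\log N)^{(d-1)/2}.$$
   Context: For a set $\mathcal P_N\subset[0,1]^d$ of cardinality $N$, its discrepancy function is $$D_N(x)=\sharp(\mathcal P_N\cap[0,x))-N\,|[0,x)|,\qquad x=(x_1,\dots,x_d)\in[0,1]^d,$$ where $[0,x)=\prod_{j=1}^d[0,x_j)$ and $|\cdot|$ is $d$-dimensional Lebesgue measure. $\|\cdot\|_p$ denotes the norm of $L^p([0,1]^d)$ with respect to Lebesgue measure. *)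

theory Defs
  imports "HOL-Analysis.Analysis"
begin

definition origin_box :: "real ^ 'n \<Rightarrow> (real ^ 'n) set" where
  "origin_box x = {y. \<forall>j. 0 \<le> y $ j \<and> y $ j < x $ j}"

definition discrepancy :: "(real ^ 'n) set \<Rightarrow> real ^ 'n \<Rightarrow> real" where
  "discrepancy P x =
     real (card (P \<inter> origin_box x)) - real (card P) * measure lborel (origin_box x)"

(* The vector 1 has all components 1, so cbox 0 1 is the closed unit cube.
   The Bochner integral is 0 for non-integrable integrands, but the discrepancy function
   of a finite set is bounded and Borel measurable on the cube, so this is its L^p norm. *)
definition Lp_norm_cube :: "real \<Rightarrow> (real ^ 'n \<Rightarrow> real) \<Rightarrow> real" where
  "Lp_norm_cube p f = (LINT x:cbox 0 1|lborel. \<bar>f x\<bar> powr p) powr (1 / p)"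

end

theory Submission
  imports Defs
begin

text \<open>
  Choose \<open>n\<close> with \<open>2N \<le> 2\<^sup>n \<le> 4N\<close>. For dyadic scales \<open>r\<close> with \<open>r\<^sub>1 + \<dots> + r\<^sub>d = n\<close> let \<open>f\<^sub>r\<close> be the
  product of the Rademacher functions of order \<open>r\<^sub>j\<close> in \<open>x\<^sub>j\<close>, restricted to the dyadic boxes of shape \<open>r\<close>
  containing no point. As in Roth's argument \<open>-\<integral> D f\<^sub>r\<close> is bounded below by a positive constant, so
  \<open>F\<close>, the sum of the \<open>f\<^sub>r\<close> over a set of about \<open>n\<^bsup>d-1\<^esup>\<close> scales, has \<open>-\<integral> D F \<ge> c n\<^bsup>d-1\<^esup>\<close>. Iterating a
  square function inequality for dyadic martingales over \<open>d - 1\<close> coordinates bounds the \<open>L\<^bsup>2m\<^esup>\<close> norm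
  of \<open>F\<close> by a multiple of \<open>n\<^bsup>(d-1)/2\<^esup>\<close>, for every \<open>m\<close>. Taking \<open>2m\<close> larger than the exponent
  conjugate to \<open>p\<close>, the bounds on \<open>D\<close> in \<open>L\<^sup>p\<close> and on \<open>F\<close> in \<open>L\<^bsup>2m\<^esup>\<close> show that the part of \<open>\<integral> D F\<close> where
  \<open>|F| > K n\<^bsup>(d-1)/2\<^esup>\<close> is negligible for large \<open>K\<close>; the rest is at most \<open>K n\<^bsup>(d-1)/2\<^esup> \<parallel>D\<parallel>\<^sub>1\<close>.

  Dyadic structure enters only through the measure preserving maps \<open>flip j k\<close>, which exchange the
  halves of the dyadic intervals of length \<open>2\<^sup>-\<^sup>k\<close> in the coordinate \<open>j\<close>: odd functions integrate to zero.
\<close>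

section \<open>Moments of dyadic square functions\<close>

primrec pm_const :: "nat \<Rightarrow> real" where
  "pm_const 0 = 0"
| "pm_const (Suc m) = pm_const m + 4 * real m * 2 ^ m"

lemma pm_const_nonneg: "0 \<le> pm_const m"
  by (induction m) auto

text \<open>Terms of first order in \<open>w\<close> cancel in the mean. In the induction, raising
  the exponent multiplies the sum of the two powers by \<open>z\<close> and adds \<open>w\<close>
  times their difference. That difference carries a factor \<open>2 * w\<close>, so the cross term
  contains \<open>w\<^sup>2\<close>, to which the second hypothesis applies; the increments of
  \<open>pm_const\<close> pay for it.\<close>

lemma power_pm_mean_le:
  fixes z w e :: real
  assumes "\<bar>w\<bar> \<le> z" "w\<^sup>2 \<le> 4 * z * e" "0 \<le> e"
  shows "(z + w) ^ Suc m + (z - w) ^ Suc m \<le> 2 * z ^ Suc m + 2 * pm_const (Suc m) * e * z ^ m"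
proof (induction m)
  case 0
  then show ?case by simp
next
  case (Suc m)
  have z: "0 \<le> z" using assms by linarith
  have diff: "w * ((z + w) ^ Suc m - (z - w) ^ Suc m) \<le> 2 * w\<^sup>2 * (real (Suc m) * (2 * z) ^ m)"
  proof -
    have eq: "(z + w) ^ Suc m - (z - w) ^ Suc m
        = 2 * w * (\<Sum>i<Suc m. (z + w) ^ i * (z - w) ^ (m - i))"
      using power_diff_sumr2[of "z + w" "Suc m" "z - w"]
      by (simp add: mult.commute)
    have "(z + w) ^ i * (z - w) ^ (m - i) \<le> (2 * z) ^ m" if "i < Suc m" for i
    proof -
      have "(z + w) ^ i \<le> (2 * z) ^ i" "(z - w) ^ (m - i) \<le> (2 * z) ^ (m - i)"
        using assms by (intro power_mono; linarith)+
      hence "(z + w) ^ i * (z - w) ^ (m - i) \<le> (2 * z) ^ i * (2 * z) ^ (m - i)"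
        using assms z by (intro mult_mono) auto
      also have "\<dots> = (2 * z) ^ m" using that by (simp only: less_Suc_eq_le flip: power_add) simp
      finally show ?thesis .
    qed
    hence "(\<Sum>i<Suc m. (z + w) ^ i * (z - w) ^ (m - i)) \<le> (\<Sum>i<Suc m. (2 * z) ^ m)"
      by (intro sum_mono) auto
    hence "2 * w\<^sup>2 * (\<Sum>i<Suc m. (z + w) ^ i * (z - w) ^ (m - i))
        \<le> 2 * w\<^sup>2 * (real (Suc m) * (2 * z) ^ m)"
      by (intro mult_left_mono) auto
    thus ?thesis unfolding eq by (simp add: power2_eq_square mult_ac)
  qed
  have "2 * w\<^sup>2 * (real (Suc m) * (2 * z) ^ m)
      \<le> 2 * (4 * z * e) * (real (Suc m) * (2 * z) ^ m)"
    using assms z by (intro mult_right_mono mult_left_mono) auto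
  also have "\<dots> = 2 * (4 * real (Suc m) * 2 ^ Suc m) / 2 * e * z ^ Suc m"
    by (simp add: power_mult_distrib)
  also have "\<dots> \<le> 2 * (4 * real (Suc m) * 2 ^ Suc m) * e * z ^ Suc m"
    using assms z by (intro mult_right_mono) auto
  finally have b: "w * ((z + w) ^ Suc m - (z - w) ^ Suc m)
      \<le> 2 * (4 * real (Suc m) * 2 ^ Suc m) * e * z ^ Suc m"
    using diff by linarith
  have "(z + w) ^ Suc (Suc m) + (z - w) ^ Suc (Suc m)
      = z * ((z + w) ^ Suc m + (z - w) ^ Suc m) + w * ((z + w) ^ Suc m - (z - w) ^ Suc m)"
    by (simp add: algebra_simps)
  also have "\<dots> \<le> z * (2 * z ^ Suc m + 2 * pm_const (Suc m) * e * z ^ m)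
      + 2 * (4 * real (Suc m) * 2 ^ Suc m) * e * z ^ Suc m"
    by (intro add_mono mult_left_mono Suc z b)
  also have "\<dots> = 2 * z ^ Suc (Suc m) + 2 * pm_const (Suc (Suc m)) * e * z ^ Suc m"
    by (simp add: algebra_simps)
  finally show ?case .
qed

text \<open>Jensen's inequality, from the same recursion: \<open>\<bar>w\<bar> \<le> z\<close> keeps
  both bases nonnegative, so \<open>w\<close> times the difference of the powers is
  nonnegative.\<close>

lemma power_pm_mean_ge:
  fixes z w :: real
  assumes "\<bar>w\<bar> \<le> z"
  shows "2 * z ^ m \<le> (z + w) ^ m + (z - w) ^ m"
proof (induction m)
  case (Suc m)
  have sgn: "0 \<le> w * ((z + w) ^ m - (z - w) ^ m)"
  proof (cases "w \<ge> 0")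
    case True
    have "(z - w) ^ m \<le> (z + w) ^ m" using assms True by (intro power_mono) auto
    with True show ?thesis by (intro mult_nonneg_nonneg) auto
  next
    case False
    have "(z + w) ^ m \<le> (z - w) ^ m" using assms False by (intro power_mono) auto
    with False show ?thesis by (intro mult_nonpos_nonpos) auto
  qed
  have "2 * z ^ Suc m = z * (2 * z ^ m)" by simp
  also have "\<dots> \<le> z * ((z + w) ^ m + (z - w) ^ m) + w * ((z + w) ^ m - (z - w) ^ m)"
    using sgn Suc assms mult_left_mono[of "2 * z ^ m" "(z + w) ^ m + (z - w) ^ m" z] by linarith
  also have "\<dots> = (z + w) ^ Suc m + (z - w) ^ Suc m" by (simp add: algebra_simps)
  finally show ?case .
qed simp

lemma power_Suc_diff_le:
  fixes y e :: real
  assumes "0 \<le> y" "0 \<le> e"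
  shows "(y + e) ^ Suc m - y ^ Suc m \<le> real (Suc m) * e * (y + e) ^ m"
proof (induction m)
  case (Suc m)
  have "(y + e) ^ Suc (Suc m) - y ^ Suc (Suc m)
      = (y + e) * ((y + e) ^ Suc m - y ^ Suc m) + e * y ^ Suc m"
    by (simp add: algebra_simps)
  also have "\<dots> \<le> (y + e) * (real (Suc m) * e * (y + e) ^ m) + e * (y + e) ^ Suc m"
    using assms Suc by (intro add_mono mult_left_mono power_mono) auto
  also have "\<dots> = real (Suc (Suc m)) * e * (y + e) ^ Suc m"
    by (simp add: algebra_simps)
  finally show ?case .
qed simp

text \<open>The summand \<open>Suc m\<close> pays for replacing \<open>y + e\<close> by
  \<open>y\<close> in the leading power, \<open>pm_const (Suc m)\<close> for the fluctuation by
  \<open>2 * t\<close>.\<close>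

definition burkholder_const :: "nat \<Rightarrow> real" where "burkholder_const m = real (Suc m) + pm_const (Suc m)"

lemma burkholder_const_ge_1: "1 \<le> burkholder_const m"
  using pm_const_nonneg[of "Suc m"] by (simp add: burkholder_const_def)

text \<open>With \<open>y = |S\<^sub>k|\<^sup>2\<close>, \<open>q = Q\<^sub>k\<close>, the increment contributes \<open>e = |d\<^sub>k|\<^sup>2\<close> to both and \<open>\<plusminus>2t = \<plusminus>2\<langle>S\<^sub>k, d\<^sub>k\<rangle>\<close> to
  \<open>y\<close>: so \<open>|S|\<^bsup>2m+2\<^esup> - c Q |S|\<^bsup>2m\<^esup>\<close> is a supermartingale.\<close>
lemma supermartingale_step:
  fixes y e q t :: real
  assumes "0 \<le> y" "0 \<le> e" "0 \<le> q" "t\<^sup>2 \<le> y * e"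
  shows "((y + e + 2 * t) ^ Suc m - burkholder_const m * (q + e) * (y + e + 2 * t) ^ m)
       + ((y + e - 2 * t) ^ Suc m - burkholder_const m * (q + e) * (y + e - 2 * t) ^ m)
       \<le> 2 * (y ^ Suc m - burkholder_const m * q * y ^ m)"
proof -
  \<comment> \<open>The arithmetic-geometric mean inequality and the bound on
    \<open>t\<^sup>2\<close> ensure that neither sign of \<open>2 * t\<close> makes
    \<open>y + e\<close> negative.\<close>
  have "4 * (y * e) \<le> (y + e)\<^sup>2"
    using zero_le_power2[of "y - e"] by (simp add: power2_eq_square algebra_simps)
  hence "(2 * t)\<^sup>2 \<le> (y + e)\<^sup>2" using assms(4) by (simp add: power_mult_distrib)
  hence w: "\<bar>2 * t\<bar> \<le> y + e"
    using assms by (metis add_nonneg_nonneg abs_le_square_iff abs_of_nonneg)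
  have w2: "(2 * t)\<^sup>2 \<le> 4 * (y + e) * e"
  proof -
    have "4 * t\<^sup>2 \<le> 4 * (y * e) + 4 * e\<^sup>2"
      using assms(4) zero_le_power2[of e] by linarith
    thus ?thesis by (simp add: power2_eq_square algebra_simps)
  qed
  note A = power_pm_mean_le[OF w w2 assms(2), of m]
  have B: "2 * (y + e) ^ m \<le> (y + e + 2 * t) ^ m + (y + e - 2 * t) ^ m"
    by (rule power_pm_mean_ge[OF w])
  have C: "(y + e) ^ Suc m - y ^ Suc m \<le> real (Suc m) * e * (y + e) ^ m"
    using power_Suc_diff_le assms by blast
  \<comment> \<open>This term is subtracted, so the mean of the powers has to be bounded from below
    here.\<close>
  have D: "burkholder_const m * (q + e) * (2 * (y + e) ^ m)
      \<le> burkholder_const m * (q + e) * ((y + e + 2 * t) ^ m + (y + e - 2 * t) ^ m)"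
    using B burkholder_const_ge_1[of m] assms by (intro mult_left_mono mult_nonneg_nonneg) auto
  have E: "burkholder_const m * q * y ^ m \<le> burkholder_const m * q * (y + e) ^ m"
    using burkholder_const_ge_1[of m] assms by (intro mult_left_mono mult_nonneg_nonneg power_mono) auto
  have "(y + e + 2 * t) ^ Suc m + (y + e - 2 * t) ^ Suc m
     \<le> 2 * y ^ Suc m + 2 * (burkholder_const m * e * (y + e) ^ m)"
    using A C by (simp add: burkholder_const_def algebra_simps)
  with D E show ?thesis by (simp add: algebra_simps)
qed

text \<open>The larger of \<open>y\<close> and \<open>2 * c * q\<close> dominates the product. The
  factor one half allows the power of \<open>y\<close> to be absorbed when the supermartingale bound
  is turned into a moment bound.\<close>

lemma young_half:
  fixes y q c :: real
  assumes "0 \<le> y" "0 \<le> q" "0 \<le> c"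
  shows "c * q * y ^ m \<le> y ^ Suc m / 2 + (2 * c * q) ^ Suc m / 2"
proof (cases "2 * c * q \<le> y")
  case True
  hence "(2 * c * q) * y ^ m \<le> y * y ^ m" using assms by (intro mult_right_mono) auto
  moreover have "0 \<le> (2 * c * q) ^ Suc m" using assms by simp
  ultimately show ?thesis unfolding power_Suc by linarith
next
  case False
  hence "(2 * c * q) * y ^ m \<le> (2 * c * q) * (2 * c * q) ^ m"
    using assms by (intro mult_left_mono power_mono) auto
  moreover have "0 \<le> y ^ Suc m" using assms by simp
  ultimately show ?thesis unfolding power_Suc by linarith
qed

lemma abs_le_imp_power2_le:
  fixes a b :: real
  assumes "\<bar>a\<bar> \<le> b"
  shows "a\<^sup>2 \<le> b\<^sup>2"
  using power_mono[OF assms, of 2] by simp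

lemma integrable_bounded:
  fixes f :: "'a \<Rightarrow> real"
  assumes "finite_measure M" "f \<in> borel_measurable M" "\<And>x. x \<in> space M \<Longrightarrow> \<bar>f x\<bar> \<le> B"
  shows "integrable M f"
  using assms by (intro finite_measure.integrable_const_bound[of M f B]) auto

text \<open>Since \<open>|d\<^sub>k|\<^sup>2\<close> is invariant under \<open>\<sigma> k\<close> (it is predictable), no maximal inequality is
  needed to pass from \<open>E |S|\<^bsup>2m+2\<^esup> \<le> c E Q |S|\<^bsup>2m\<^esup>\<close> to the moment bound.\<close>
lemma square_function_moment:
  fixes M :: "'a measure" and \<sigma> :: "nat \<Rightarrow> 'a \<Rightarrow> 'a" and d :: "'i \<Rightarrow> nat \<Rightarrow> 'a \<Rightarrow> real"
  assumes fin: "finite_measure M" and "finite I"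
    and \<sigma>: "\<And>k. \<sigma> k \<in> M \<rightarrow>\<^sub>M M" "\<And>k. distr M M (\<sigma> k) = M"
    and meas: "\<And>i k. d i k \<in> borel_measurable M"
    and bdd: "\<And>i k x. x \<in> space M \<Longrightarrow> \<bar>d i k x\<bar> \<le> B"
    and odd: "\<And>i k x. x \<in> space M \<Longrightarrow> d i k (\<sigma> k x) = - d i k x"
    and inv: "\<And>i k l x. x \<in> space M \<Longrightarrow> k < l \<Longrightarrow> d i k (\<sigma> l x) = d i k x"
  shows "(\<integral>x. (\<Sum>i\<in>I. (\<Sum>k<n. d i k x)\<^sup>2) ^ Suc m \<partial>M)
    \<le> (2 * burkholder_const m) ^ Suc m * (\<integral>x. (\<Sum>i\<in>I. \<Sum>k<n. (d i k x)\<^sup>2) ^ Suc m \<partial>M)"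
proof -
  interpret finite_measure M by fact
  define S where "S k i x = (\<Sum>l<k. d i l x)" for k i x
  define Y where "Y k x = (\<Sum>i\<in>I. (S k i x)\<^sup>2)" for k x
  define Q where "Q k x = (\<Sum>i\<in>I. \<Sum>l<k. (d i l x)\<^sup>2)" for k x
  define \<Phi> where "\<Phi> k x = Y k x ^ Suc m - burkholder_const m * Q k x * Y k x ^ m" for k x
  have Sm[measurable]: "S k i \<in> borel_measurable M" for k i
    unfolding S_def using meas by measurable
  have Ym[measurable]: "Y k \<in> borel_measurable M" for k
    unfolding Y_def by measurable
  have Qm[measurable]: "Q k \<in> borel_measurable M" for k
    unfolding Q_def using meas by measurable
  have Y0: "0 \<le> Y k x" for k x unfolding Y_def by (intro sum_nonneg) auto
  have Q0: "0 \<le> Q k x" for k x unfolding Q_def by (intro sum_nonneg) auto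
  have "\<exists>C. \<forall>x\<in>space M. \<bar>Y k x\<bar> \<le> C" for k
  proof (intro exI ballI)
    fix x assume x: "x \<in> space M"
    have "\<bar>S k i x\<bar> \<le> (\<Sum>l<k. B)" for i
      unfolding S_def by (rule order_trans[OF sum_abs]) (intro sum_mono bdd x)
    hence "(S k i x)\<^sup>2 \<le> (\<Sum>l<k. B)\<^sup>2" for i
      by (rule abs_le_imp_power2_le)
    hence "Y k x \<le> (\<Sum>i\<in>I. (\<Sum>l<k. B)\<^sup>2)"
      unfolding Y_def by (intro sum_mono) auto
    thus "\<bar>Y k x\<bar> \<le> (\<Sum>i\<in>I. (\<Sum>l<k. B)\<^sup>2)" using Y0[of k x] by simp
  qed
  then obtain CY where CY: "\<And>k x. x \<in> space M \<Longrightarrow> \<bar>Y k x\<bar> \<le> CY k" by metis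
  have "\<exists>C. \<forall>x\<in>space M. \<bar>Q k x\<bar> \<le> C" for k
  proof (intro exI ballI)
    fix x assume x: "x \<in> space M"
    have "(d i l x)\<^sup>2 \<le> B\<^sup>2" for i l
      using bdd[OF x] by (rule abs_le_imp_power2_le)
    hence "Q k x \<le> (\<Sum>i\<in>I. \<Sum>l<k. B\<^sup>2)"
      unfolding Q_def by (intro sum_mono) auto
    thus "\<bar>Q k x\<bar> \<le> (\<Sum>i\<in>I. \<Sum>l<k. B\<^sup>2)" using Q0[of k x] by simp
  qed
  then obtain CQ where CQ: "\<And>k x. x \<in> space M \<Longrightarrow> \<bar>Q k x\<bar> \<le> CQ k" by metis
  have intY: "integrable M (\<lambda>x. Y k x ^ a)" for k a
  proof (rule integrable_bounded[OF fin, where B = "CY k ^ a"])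
    show "\<And>x. x \<in> space M \<Longrightarrow> \<bar>Y k x ^ a\<bar> \<le> CY k ^ a"
      using CY[of _ k] by (auto simp: power_abs intro!: power_mono)
  qed measurable
  have intQ: "integrable M (\<lambda>x. Q k x ^ a)" for k a
  proof (rule integrable_bounded[OF fin, where B = "CQ k ^ a"])
    show "\<And>x. x \<in> space M \<Longrightarrow> \<bar>Q k x ^ a\<bar> \<le> CQ k ^ a"
      using CQ[of _ k] by (auto simp: power_abs intro!: power_mono)
  qed measurable
  have intQY: "integrable M (\<lambda>x. Q k x * Y k x ^ a)" for k a
  proof (rule integrable_bounded[OF fin, where B = "CQ k * CY k ^ a"])
    show "\<bar>Q k x * Y k x ^ a\<bar> \<le> CQ k * CY k ^ a" if "x \<in> space M" for x
      unfolding abs_mult power_abs using CY[OF that, of k] CQ[OF that, of k]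
      by (intro mult_mono power_mono) auto
  qed measurable
  have int\<Phi>: "integrable M (\<Phi> k)" for k
  proof -
    have "integrable M (\<lambda>x. Y k x ^ Suc m - burkholder_const m * (Q k x * Y k x ^ m))"
      by (intro Bochner_Integration.integrable_diff integrable_mult_right intY intQY)
    thus ?thesis unfolding \<Phi>_def by (simp add: mult.assoc)
  qed
  have step: "(\<integral>x. \<Phi> (Suc k) x \<partial>M) \<le> (\<integral>x. \<Phi> k x \<partial>M)" for k
  proof -
    have \<sigma>int: "(\<integral>x. \<Phi> (Suc k) (\<sigma> k x) \<partial>M) = (\<integral>x. \<Phi> (Suc k) x \<partial>M)"
      using integral_distr[OF \<sigma>(1)[of k], of "\<Phi> (Suc k)"] int\<Phi>[of "Suc k"] \<sigma>(2)[of k]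
      by (metis borel_measurable_integrable)
    have \<sigma>able: "integrable M (\<lambda>x. \<Phi> (Suc k) (\<sigma> k x))"
      using integrable_distr[OF \<sigma>(1)[of k], of "\<Phi> (Suc k)"] int\<Phi>[of "Suc k"] \<sigma>(2)[of k]
      by metis
    \<comment> \<open>Under \<open>\<sigma> k\<close> the increments \<open>d i k\<close> change
      sign while \<open>S k\<close> and \<open>Q (Suc k)\<close> stay fixed. The sum over the two
      points is thus twice a conditional expectation given the past.\<close>
    have pw: "\<Phi> (Suc k) x + \<Phi> (Suc k) (\<sigma> k x) \<le> 2 * \<Phi> k x" if x: "x \<in> space M" for x
    proof -
      define e where "e = (\<Sum>i\<in>I. (d i k x)\<^sup>2)"
      define t where "t = (\<Sum>i\<in>I. S k i x * d i k x)"
      have S\<sigma>: "S k i (\<sigma> k x) = S k i x" for i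
        unfolding S_def using inv[OF x] by (intro sum.cong) auto
      have 1: "Y (Suc k) x = Y k x + e + 2 * t"
        unfolding Y_def e_def t_def S_def
        by (simp add: power2_sum sum.distrib sum_distrib_left mult_ac)
      have "S (Suc k) i (\<sigma> k x) = S k i x - d i k x" for i
        using S\<sigma>[of i] odd[OF x, of i k] by (simp add: S_def)
      hence 2: "Y (Suc k) (\<sigma> k x) = Y k x + e - 2 * t"
        unfolding Y_def e_def t_def
        by (simp add: power2_diff sum.distrib sum_subtractf sum_distrib_left mult_ac)
      have 3: "Q (Suc k) x = Q k x + e"
        unfolding Q_def e_def by (simp add: sum.distrib)
      have 4: "Q (Suc k) (\<sigma> k x) = Q k x + e"
        unfolding Q_def e_def using inv[OF x] odd[OF x] by (simp add: sum.distrib)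
      have "0 \<le> e" unfolding e_def by (intro sum_nonneg) auto
      moreover have "t\<^sup>2 \<le> Y k x * e"
        unfolding t_def Y_def e_def by (rule Cauchy_Schwarz_ineq_sum)
      ultimately show ?thesis
        using supermartingale_step[of "Y k x" e "Q k x" t m] Y0[of k x] Q0[of k x]
        unfolding \<Phi>_def 1 2 3 4 by blast
    qed
    have "(\<integral>x. \<Phi> (Suc k) x + \<Phi> (Suc k) (\<sigma> k x) \<partial>M) \<le> (\<integral>x. 2 * \<Phi> k x \<partial>M)"
      using pw by (intro integral_mono Bochner_Integration.integrable_add \<sigma>able int\<Phi>
          integrable_mult_right) auto
    thus ?thesis using \<sigma>int int\<Phi> \<sigma>able by simp
  qed
  have "(\<integral>x. \<Phi> k x \<partial>M) \<le> 0" for k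
  proof (induction k)
    case 0
    then show ?case by (simp add: \<Phi>_def Y_def S_def Q_def)
  qed (use step order_trans in blast)
  moreover have "(\<integral>x. Y n x ^ Suc m / 2 - (2 * burkholder_const m) ^ Suc m * Q n x ^ Suc m / 2 \<partial>M)
      \<le> (\<integral>x. \<Phi> n x \<partial>M)"
  proof (rule integral_mono)
    fix x
    show "Y n x ^ Suc m / 2 - (2 * burkholder_const m) ^ Suc m * Q n x ^ Suc m / 2 \<le> \<Phi> n x"
      using young_half[of "Y n x" "Q n x" "burkholder_const m" m] Y0[of n x] Q0[of n x] burkholder_const_ge_1[of m]
      unfolding \<Phi>_def power_mult_distrib by simp
  qed (intro Bochner_Integration.integrable_diff integrable_divide integrable_mult_right
        intY intQ int\<Phi>)+
  ultimately have "(\<integral>x. Y n x ^ Suc m / 2 - (2 * burkholder_const m) ^ Suc m * Q n x ^ Suc m / 2 \<partial>M) \<le> 0"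
    by (meson order_trans)
  moreover have "(\<integral>x. Y n x ^ Suc m / 2 - (2 * burkholder_const m) ^ Suc m * Q n x ^ Suc m / 2 \<partial>M)
     = (\<integral>x. Y n x ^ Suc m \<partial>M) / 2 - (2 * burkholder_const m) ^ Suc m * (\<integral>x. Q n x ^ Suc m \<partial>M) / 2"
    using intY intQ by (simp del: power_Suc)
  ultimately show ?thesis unfolding Y_def Q_def S_def by simp
qed

section \<open>Iteration of the square function inequality over coordinates\<close>

lemma sum_PiE_insert:
  assumes "j \<notin> J" "finite J" "finite S"
  shows "(\<Sum>i\<in>PiE J (\<lambda>_. S). \<Sum>k\<in>S. g (i(j := k))) = (\<Sum>i\<in>PiE (insert j J) (\<lambda>_. S). g i)"
proof -
  have "(\<Sum>i\<in>PiE (insert j J) (\<lambda>_. S). g i)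
      = (\<Sum>(k, i)\<in>S \<times> PiE J (\<lambda>_. S). g (i(j := k)))"
    unfolding PiE_insert_eq
    by (subst sum.reindex[OF inj_combinator[OF assms(1)]]) (simp add: case_prod_unfold comp_def)
  also have "\<dots> = (\<Sum>k\<in>S. \<Sum>i\<in>PiE J (\<lambda>_. S). g (i(j := k)))"
    by (simp add: sum.cartesian_product)
  also have "\<dots> = (\<Sum>i\<in>PiE J (\<lambda>_. S). \<Sum>k\<in>S. g (i(j := k)))"
    by (rule sum.swap)
  finally show ?thesis by simp
qed

text \<open>\<open>G J\<close> is the square function in the coordinates of \<open>J\<close>: sums
  over the remaining freedom of \<open>r\<close> stay inside the square. To add a coordinate
  \<open>j\<close>, each inner sum is split by the value of \<open>r j\<close>. The pieces are
  martingale differences for \<open>\<sigma> j\<close>, and the outer index \<open>i\<close> makes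
  them vector valued, which is why \<open>square_function_moment\<close> carries a sum over
  \<open>I\<close>. Each coordinate costs one constant factor.\<close>

lemma iterated_square_function:
  fixes M :: "'a measure" and \<sigma> :: "'j \<Rightarrow> nat \<Rightarrow> 'a \<Rightarrow> 'a" and f :: "('j \<Rightarrow> nat) \<Rightarrow> 'a \<Rightarrow> real"
  assumes fin: "finite_measure M" and A: "finite A" and K: "finite K"
    and \<sigma>: "\<And>j k. j \<in> K \<Longrightarrow> \<sigma> j k \<in> M \<rightarrow>\<^sub>M M" "\<And>j k. j \<in> K \<Longrightarrow> distr M M (\<sigma> j k) = M"
    and meas: "\<And>r. r \<in> A \<Longrightarrow> f r \<in> borel_measurable M"
    and bdd: "\<And>r x. r \<in> A \<Longrightarrow> x \<in> space M \<Longrightarrow> \<bar>f r x\<bar> \<le> 1"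
    and odd: "\<And>r j x. r \<in> A \<Longrightarrow> j \<in> K \<Longrightarrow> x \<in> space M \<Longrightarrow> f r (\<sigma> j (r j) x) = - f r x"
    and inv: "\<And>r j l x. r \<in> A \<Longrightarrow> j \<in> K \<Longrightarrow> x \<in> space M \<Longrightarrow> r j < l \<Longrightarrow> f r (\<sigma> j l x) = f r x"
    and B: "\<And>r j. r \<in> A \<Longrightarrow> r j < B"
  defines "G \<equiv> \<lambda>J x. \<Sum>i\<in>PiE J (\<lambda>_. {..<B}). (\<Sum>r | r \<in> A \<and> restrict r J = i. f r x)\<^sup>2"
  assumes "J \<subseteq> K"
  shows "(\<integral>x. (\<Sum>r\<in>A. f r x) ^ (2 * Suc m) \<partial>M)
    \<le> ((2 * burkholder_const m) ^ Suc m) ^ card J * (\<integral>x. G J x ^ Suc m \<partial>M)"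
proof -
  define C where "C = (2 * burkholder_const m) ^ Suc m"
  have C: "0 \<le> C" using burkholder_const_ge_1[of m] unfolding C_def by simp
  have "finite J" using \<open>J \<subseteq> K\<close> K by (rule finite_subset)
  thus ?thesis using \<open>J \<subseteq> K\<close> unfolding C_def[symmetric]
  proof (induction J rule: finite_induct)
    case empty
    \<comment> \<open>\<open>PiE\<close> over the empty set has one element, to which every
      \<open>r\<close> restricts, so \<open>G {}\<close> is the square of the full sum.\<close>
    have "{r. r \<in> A \<and> restrict r {} = (\<lambda>_. undefined)} = A" by (auto simp: restrict_def)
    thus ?case unfolding G_def power_mult[of _ 2 "Suc m"] by (simp del: power_Suc)
  next
    case (insert j J)
    have jK: "j \<in> K" using insert.prems by blast
    define d where "d i k x = (\<Sum>r | r \<in> A \<and> restrict r J = i \<and> r j = k. f r x)" for i k x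
    have sq: "(\<integral>x. (\<Sum>i\<in>PiE J (\<lambda>_. {..<B}). (\<Sum>k<B. d i k x)\<^sup>2) ^ Suc m \<partial>M)
      \<le> (2 * burkholder_const m) ^ Suc m * (\<integral>x. (\<Sum>i\<in>PiE J (\<lambda>_. {..<B}). \<Sum>k<B. (d i k x)\<^sup>2) ^ Suc m \<partial>M)"
    proof (rule square_function_moment[OF fin, where \<sigma> = "\<sigma> j" and B = "real (card A)"])
      show "finite (J \<rightarrow>\<^sub>E {..<B})" using insert.hyps by (intro finite_PiE) auto
      show "\<And>k. \<sigma> j k \<in> M \<rightarrow>\<^sub>M M" "\<And>k. distr M M (\<sigma> j k) = M" using \<sigma> jK by auto
      show "d i k \<in> borel_measurable M" for i k
        unfolding d_def using meas by (intro borel_measurable_sum) auto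
      show "\<bar>d i k x\<bar> \<le> real (card A)" if "x \<in> space M" for i k x
      proof -
        have "\<bar>d i k x\<bar> \<le> (\<Sum>r | r \<in> A \<and> restrict r J = i \<and> r j = k. 1)"
          unfolding d_def by (rule order_trans[OF sum_abs]) (intro sum_mono, use bdd that in auto)
        also have "\<dots> \<le> (\<Sum>r\<in>A. 1)" using A by (intro sum_mono2) auto
        finally show ?thesis by simp
      qed
      show "d i k (\<sigma> j k x) = - d i k x" if "x \<in> space M" for i k x
        unfolding d_def sum_negf[symmetric] using odd[OF _ jK that] by (intro sum.cong) auto
      show "d i k (\<sigma> j l x) = d i k x" if "x \<in> space M" "k < l" for i k l x
        unfolding d_def using inv[OF _ jK that(1)] that(2) by (intro sum.cong) auto
    qed
    have inner: "(\<Sum>k<B. d i k x) = (\<Sum>r | r \<in> A \<and> restrict r J = i. f r x)" for i x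
    proof -
      have "(\<Sum>r | r \<in> A \<and> restrict r J = i. f r x)
          = (\<Sum>k<B. \<Sum>r\<in>{r\<in>{r. r \<in> A \<and> restrict r J = i}. r j = k}. f r x)"
        using A B by (intro sum.group[symmetric]) auto
      also have "\<dots> = (\<Sum>k<B. d i k x)"
        unfolding d_def by (intro sum.cong refl) auto
      finally show ?thesis by simp
    qed
    have outer: "(\<Sum>i\<in>PiE J (\<lambda>_. {..<B}). \<Sum>k<B. (d i k x)\<^sup>2) = G (insert j J) x" for x
    proof -
      \<comment> \<open>Fixing \<open>r\<close> on \<open>J\<close> and then at \<open>j\<close> is
        fixing it on \<open>insert j J\<close>; extensionality of \<open>i\<close> settles the
        arguments outside \<open>J\<close>.\<close>
      have "restrict r J = i \<and> r j = k \<longleftrightarrow> restrict r (insert j J) = i(j := k)"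
        if "i \<in> PiE J (\<lambda>_. {..<B})" for i k and r :: "'j \<Rightarrow> nat"
      proof
        assume "restrict r J = i \<and> r j = k"
        thus "restrict r (insert j J) = i(j := k)"
          by (auto simp: fun_eq_iff restrict_def)
      next
        assume *: "restrict r (insert j J) = i(j := k)"
        have "restrict r J l = i l" for l
        proof (cases "l \<in> J")
          case True
          with fun_cong[OF *, of l] insert.hyps(2) show ?thesis by (auto split: if_splits)
        next
          case False
          with that show ?thesis by (auto simp: PiE_def extensional_def)
        qed
        with fun_cong[OF *, of j] show "restrict r J = i \<and> r j = k" by auto
      qed
      hence "(\<Sum>i\<in>PiE J (\<lambda>_. {..<B}). \<Sum>k<B. (d i k x)\<^sup>2)
        = (\<Sum>i\<in>PiE J (\<lambda>_. {..<B}). \<Sum>k<B.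
             (\<Sum>r | r \<in> A \<and> restrict r (insert j J) = i(j := k). f r x)\<^sup>2)"
        unfolding d_def by (intro sum.cong refl) simp
      also have "\<dots> = G (insert j J) x"
        unfolding G_def by (rule sum_PiE_insert) (use insert.hyps in auto)
      finally show ?thesis .
    qed
    have step: "(\<integral>x. G J x ^ Suc m \<partial>M) \<le> C * (\<integral>x. G (insert j J) x ^ Suc m \<partial>M)"
      using sq unfolding inner outer C_def G_def .
    have "(\<integral>x. (\<Sum>r\<in>A. f r x) ^ (2 * Suc m) \<partial>M) \<le> C ^ card J * (\<integral>x. G J x ^ Suc m \<partial>M)"
      using insert by blast
    also have "\<dots> \<le> C ^ card J * (C * (\<integral>x. G (insert j J) x ^ Suc m \<partial>M))"
      using step C by (intro mult_left_mono) auto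
    finally show ?case using insert.hyps by (simp add: mult_ac)
  qed
qed

text \<open>If the coordinates in \<open>K\<close> determine \<open>r\<close>, each inner sum of the
  square function over \<open>K\<close> has at most one term. The square function is then bounded
  pointwise by \<open>card A\<close>, so the sum has moments of the order of a power of the square
  root of \<open>card A\<close>.\<close>

lemma hyperbolic_sum_moment:
  fixes M :: "'a measure" and \<sigma> :: "'j \<Rightarrow> nat \<Rightarrow> 'a \<Rightarrow> 'a" and f :: "('j \<Rightarrow> nat) \<Rightarrow> 'a \<Rightarrow> real"
  assumes fin: "finite_measure M" and A: "finite A" and K: "finite K"
    and \<sigma>: "\<And>j k. j \<in> K \<Longrightarrow> \<sigma> j k \<in> M \<rightarrow>\<^sub>M M" "\<And>j k. j \<in> K \<Longrightarrow> distr M M (\<sigma> j k) = M"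
    and meas: "\<And>r. r \<in> A \<Longrightarrow> f r \<in> borel_measurable M"
    and bdd: "\<And>r x. r \<in> A \<Longrightarrow> x \<in> space M \<Longrightarrow> \<bar>f r x\<bar> \<le> 1"
    and odd: "\<And>r j x. r \<in> A \<Longrightarrow> j \<in> K \<Longrightarrow> x \<in> space M \<Longrightarrow> f r (\<sigma> j (r j) x) = - f r x"
    and inv: "\<And>r j l x. r \<in> A \<Longrightarrow> j \<in> K \<Longrightarrow> x \<in> space M \<Longrightarrow> r j < l \<Longrightarrow> f r (\<sigma> j l x) = f r x"
    and B: "\<And>r j. r \<in> A \<Longrightarrow> r j < B"
    and inj: "inj_on (\<lambda>r. restrict r K) A"
  shows "(\<integral>x. (\<Sum>r\<in>A. f r x) ^ (2 * Suc m) \<partial>M)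
    \<le> ((2 * burkholder_const m) ^ Suc m) ^ card K * (real (card A) ^ Suc m * measure M (space M))"
proof -
  define G where "G x = (\<Sum>i\<in>PiE K (\<lambda>_. {..<B}). (\<Sum>r | r \<in> A \<and> restrict r K = i. f r x)\<^sup>2)" for x
  have G0: "0 \<le> G x" for x unfolding G_def by (intro sum_nonneg) auto
  have G: "G x \<le> real (card A)" if x: "x \<in> space M" for x
  proof -
    have "(\<Sum>r | r \<in> A \<and> restrict r K = i. f r x)\<^sup>2
        = (\<Sum>r\<in>{r\<in>A. restrict r K = i}. (f r x)\<^sup>2)" for i
    proof (cases "\<exists>r\<in>A. restrict r K = i")
      case True
      then obtain r where "r \<in> A" "restrict r K = i" by blast
      hence "{r\<in>A. restrict r K = i} = {r}" using inj by (auto simp: inj_on_def)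
      thus ?thesis by simp
    next
      case False
      hence "{r\<in>A. restrict r K = i} = {}" by blast
      thus ?thesis by (simp only: sum.empty power_zero_numeral)
    qed
    hence "G x = (\<Sum>i\<in>PiE K (\<lambda>_. {..<B}). \<Sum>r\<in>{r\<in>A. restrict r K = i}. (f r x)\<^sup>2)"
      unfolding G_def by simp
    also have "\<dots> = (\<Sum>r\<in>A. (f r x)\<^sup>2)"
      using A K B by (intro sum.group finite_PiE) auto
    also have "\<dots> \<le> (\<Sum>r\<in>A. 1)"
      using bdd[OF _ x] by (intro sum_mono) (auto simp: abs_square_le_1)
    finally show ?thesis by simp
  qed
  have "(\<integral>x. (\<Sum>r\<in>A. f r x) ^ (2 * Suc m) \<partial>M)
    \<le> ((2 * burkholder_const m) ^ Suc m) ^ card K * (\<integral>x. G x ^ Suc m \<partial>M)"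
    unfolding G_def using iterated_square_function[where M = M and \<sigma> = \<sigma> and f = f and A = A and K = K and B = B
        and J = K and m = m] fin A K \<sigma> meas bdd odd inv B
    by blast
  also have "\<dots> \<le> ((2 * burkholder_const m) ^ Suc m) ^ card K * (\<integral>x. real (card A) ^ Suc m \<partial>M)"
  proof (intro mult_left_mono integral_mono)
    have Gm: "G \<in> borel_measurable M"
      unfolding G_def using meas by (intro borel_measurable_sum borel_measurable_power) auto
    show "integrable M (\<lambda>x. G x ^ Suc m)"
      by (rule integrable_bounded[OF fin, where B = "real (card A) ^ Suc m"])
        (use Gm G G0 in \<open>auto intro!: power_mono simp: power_abs simp del: power_Suc\<close>)
    show "integrable M (\<lambda>x. real (card A) ^ Suc m)"
      using fin by (simp add: finite_measure.integrable_const)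
    show "G x ^ Suc m \<le> real (card A) ^ Suc m" if "x \<in> space M" for x
      using G[OF that] G0 by (intro power_mono)
    show "0 \<le> ((2 * burkholder_const m) ^ Suc m) ^ card K" using burkholder_const_ge_1[of m] by simp
  qed
  finally show ?thesis
    by (simp only: lebesgue_integral_const real_scaleR_def mult.commute[of "measure M (space M)"])
qed

section \<open>Dyadic flips of the unit cube\<close>

lemma floor_pow2_div:
  fixes t :: real
  assumes "l \<le> k"
  shows "\<lfloor>2 ^ l * t\<rfloor> = \<lfloor>2 ^ k * t\<rfloor> div 2 ^ (k - l)"
proof -
  have "(2::real) ^ k = 2 ^ (k - l) * 2 ^ l" using assms by (simp flip: power_add)
  hence "2 ^ l * t = 2 ^ k * t / real_of_int (2 ^ (k - l))" by simp
  thus ?thesis by (simp only: floor_divide_real_eq_div zero_le_power zero_le_numeral)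
qed

text \<open>The parity of the floor tells in which half of its dyadic interval of length
  \<open>2 ^ - k\<close> the point lies. With half-open intervals on the whole line there are no
  exceptional points.\<close>

definition sflip :: "nat \<Rightarrow> real \<Rightarrow> real" where
  "sflip k t = (if even \<lfloor>2 ^ Suc k * t\<rfloor> then t + 1 / 2 ^ Suc k else t - 1 / 2 ^ Suc k)"

text \<open>The sign is negative on the left half, which makes the mean of
  \<open>t * rademacher k t\<close> over a flip orbit positive.\<close>

definition rademacher :: "nat \<Rightarrow> real \<Rightarrow> real" where
  "rademacher k t = (if even \<lfloor>2 ^ Suc k * t\<rfloor> then -1 else 1)"

lemma floor_sflip:
  "\<lfloor>2 ^ Suc k * sflip k t\<rfloor>
    = (if even \<lfloor>2 ^ Suc k * t\<rfloor> then \<lfloor>2 ^ Suc k * t\<rfloor> + 1 else \<lfloor>2 ^ Suc k * t\<rfloor> - 1)"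
proof -
  have "2 ^ Suc k * (t + 1 / 2 ^ Suc k) = 2 ^ Suc k * t + 1"
    "2 ^ Suc k * (t - 1 / 2 ^ Suc k) = 2 ^ Suc k * t - 1"
    by (simp_all add: field_simps)
  thus ?thesis by (simp add: sflip_def del: power_Suc)
qed

text \<open>The flip exchanges the cells \<open>2 * a\<close> and \<open>2 * a + 1\<close>, which
  have the same parent, and coarser cells are determined by the parent.\<close>

lemma floor_sflip_coarse:
  assumes "l \<le> k"
  shows "\<lfloor>2 ^ l * sflip k t\<rfloor> = \<lfloor>2 ^ l * t\<rfloor>"
proof -
  have "\<lfloor>2 ^ Suc k * sflip k t\<rfloor> div 2 = \<lfloor>2 ^ Suc k * t\<rfloor> div 2"
    unfolding floor_sflip by (auto elim!: evenE oddE simp del: power_Suc)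
  hence "\<lfloor>2 ^ k * sflip k t\<rfloor> = \<lfloor>2 ^ k * t\<rfloor>"
    using floor_pow2_div[of k "Suc k" "sflip k t"] floor_pow2_div[of k "Suc k" t] by simp
  thus ?thesis by (simp add: floor_pow2_div[OF assms])
qed

lemma rademacher_sflip: "rademacher k (sflip k t) = - rademacher k t"
  unfolding rademacher_def floor_sflip by simp

lemma rademacher_sflip_fine: "k < l \<Longrightarrow> rademacher k (sflip l t) = rademacher k t"
  unfolding rademacher_def by (subst floor_sflip_coarse) auto

lemma abs_rademacher: "\<bar>rademacher k t\<bar> = 1"
  by (simp add: rademacher_def)

lemma rademacher_mean: "t * rademacher k t + sflip k t * rademacher k (sflip k t) = 1 / 2 ^ Suc k"
  unfolding rademacher_sflip by (simp add: rademacher_def sflip_def algebra_simps)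

section \<open>Flips of one coordinate as measure preserving maps of the cube\<close>

definition flip :: "'n \<Rightarrow> nat \<Rightarrow> real ^ 'n \<Rightarrow> real ^ 'n" where
  "flip j k x = (\<chi> i. if i = j then sflip k (x $ j) else x $ i)"

lemma flip_nth [simp]: "flip j k x $ i = (if i = j then sflip k (x $ i) else x $ i)"
  by (simp add: flip_def)

text \<open>Half-open, so that it is a union of dyadic cells and exactly invariant under flips; it
  differs from \<open>cbox 0 1\<close> by a null set.\<close>

definition ucube :: "(real ^ 'n) set" where
  "ucube = {x. \<forall>j. 0 \<le> x $ j \<and> x $ j < 1}"

abbreviation cubeM :: "(real ^ 'n::finite) measure" where
  "cubeM \<equiv> restrict_space lborel ucube"

lemma ucube_iff_floor: "x \<in> ucube \<longleftrightarrow> (\<forall>j. \<lfloor>2 ^ 0 * x $ j\<rfloor> = 0)"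
  by (simp add: ucube_def floor_eq_iff)

lemma flip_in_ucube: "flip j k x \<in> ucube \<longleftrightarrow> x \<in> ucube"
  unfolding ucube_iff_floor flip_nth
  by (rule iff_allI) (auto simp only: floor_sflip_coarse split: if_splits)

lemma sets_ucube [measurable]: "(ucube :: (real ^ 'n::finite) set) \<in> sets borel"
  unfolding ucube_def by measurable

lemma space_cubeM [simp]: "space (cubeM :: (real ^ 'n::finite) measure) = ucube"
  by (simp add: space_restrict_space)

lemma borel_measurable_cubeM:
  fixes f :: "real ^ 'n::finite \<Rightarrow> real"
  shows "f \<in> borel_measurable borel \<Longrightarrow> f \<in> borel_measurable cubeM"
  by (rule measurable_restrict_space1) simp

lemma emeasure_lborel_ucube: "emeasure lborel (ucube :: (real ^ 'n::finite) set) = 1"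
proof -
  have "box 0 1 \<subseteq> (ucube :: (real ^ 'n) set)" "ucube \<subseteq> (cbox 0 1 :: (real ^ 'n) set)"
    by (auto simp: ucube_def mem_box_cart less_imp_le)
  moreover have "emeasure lborel (box 0 (1 :: real ^ 'n)) = 1" "emeasure lborel (cbox 0 (1 :: real ^ 'n)) = 1"
    by (auto simp: emeasure_lborel_box_eq emeasure_lborel_cbox_eq Basis_vec_def inner_axis
        intro!: prod.neutral)
  ultimately show ?thesis
    by (metis emeasure_mono antisym sets_ucube sets_lborel borel_closed closed_cbox)
qed

lemma finite_measure_cubeM: "finite_measure (cubeM :: (real ^ 'n::finite) measure)"
  by (rule finite_measureI) (simp add: emeasure_restrict_space emeasure_lborel_ucube)

lemma measure_cubeM: "measure cubeM (ucube :: (real ^ 'n::finite) set) = 1"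
  by (simp add: measure_def emeasure_restrict_space emeasure_lborel_ucube)

lemma flip_eq_translate:
  "flip j k x = (if even \<lfloor>2 ^ Suc k * x $ j\<rfloor> then 1 / 2 ^ Suc k else - 1 / 2 ^ Suc k) *\<^sub>R axis j 1 + x"
  by (auto simp: vec_eq_iff sflip_def axis_def)

lemma flip_measurable_borel [measurable]:
  "(flip j k :: real ^ 'n::finite \<Rightarrow> _) \<in> borel_measurable borel"
  unfolding flip_eq_translate[abs_def] by measurable

lemma flip_measurable: "(flip j k :: real ^ 'n::finite \<Rightarrow> _) \<in> cubeM \<rightarrow>\<^sub>M cubeM"
  by (rule measurable_restrict_space3) (auto simp: flip_in_ucube)

lemma emeasure_lborel_vimage_plus:
  fixes c :: "'a::euclidean_space"
  assumes "A \<in> sets borel"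
  shows "emeasure lborel ((+) c -` A) = emeasure lborel A"
proof -
  have "emeasure lborel A = emeasure (distr lborel borel ((+) c)) A"
    by (simp add: lborel_distr_plus)
  also have "\<dots> = emeasure lborel ((+) c -` A)"
    using assms by (subst emeasure_distr) auto
  finally show ?thesis by simp
qed

text \<open>On the set \<open>E\<close> of even cells the flip is translation by \<open>c\<close>,
  elsewhere by \<open>- c\<close>, and both translations exchange \<open>E\<close> with its
  complement. The preimage of \<open>A\<close> is therefore the disjoint union of a translate of
  \<open>A - E\<close> and a translate of \<open>A \<inter> E\<close>.\<close>

lemma flip_measure_preserving:
  "distr cubeM cubeM (flip j k :: real ^ 'n::finite \<Rightarrow> _) = cubeM"
proof (rule measure_eqI)
  fix A assume "A \<in> sets (distr cubeM cubeM (flip j k :: real ^ 'n \<Rightarrow> _))"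
  hence A: "A \<in> sets borel" "A \<subseteq> ucube" "A \<in> sets cubeM"
    by (auto simp: sets_restrict_space_iff)
  define E where "E = {x :: real ^ 'n. even \<lfloor>2 ^ Suc k * x $ j\<rfloor>}"
  have E[measurable]: "E \<in> sets borel" unfolding E_def by measurable
  define c :: "real ^ 'n" where "c = (1 / 2 ^ Suc k) *\<^sub>R axis j 1"
  have c: "2 ^ Suc k * (c + x) $ j = 2 ^ Suc k * x $ j + 1"
      "2 ^ Suc k * (- c + x) $ j = 2 ^ Suc k * x $ j - 1" for x
    by (simp_all add: c_def axis_def field_simps)
  have flip1: "flip j k x = c + x" if "x \<in> E" for x
    using that by (simp add: flip_eq_translate E_def c_def del: power_Suc)
  have flip2: "flip j k x = - c + x" if "x \<notin> E" for x
    using that by (simp add: flip_eq_translate E_def c_def del: power_Suc)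
  have cE: "c + x \<in> E \<longleftrightarrow> x \<notin> E" "- c + x \<in> E \<longleftrightarrow> x \<notin> E" for x
    unfolding E_def mem_Collect_eq c by simp_all
  have eq: "flip j k -` A \<inter> ucube = (+) c -` (A - E) \<union> (+) (- c) -` (A \<inter> E)"
  proof (rule set_eqI)
    fix x
    show "x \<in> flip j k -` A \<inter> ucube \<longleftrightarrow> x \<in> (+) c -` (A - E) \<union> (+) (- c) -` (A \<inter> E)"
      using A(2) flip_in_ucube[of j k x] flip1[of x] flip2[of x] cE[of x]
      by (cases "x \<in> E") (auto simp del: flip_nth)
  qed
  have m: "(+) c -` (A - E) \<in> sets lborel" "(+) (- c) -` (A \<inter> E) \<in> sets lborel"
    using A(1) by (auto intro!: measurable_sets_borel[of _ borel])
  have dis: "(+) c -` (A - E) \<inter> (+) (- c) -` (A \<inter> E) = {}"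
    using cE by blast
  have "emeasure (distr cubeM cubeM (flip j k)) A = emeasure cubeM (flip j k -` A \<inter> ucube)"
    using A flip_measurable by (subst emeasure_distr) auto
  also have "\<dots> = emeasure lborel (flip j k -` A \<inter> ucube)"
    by (subst emeasure_restrict_space) auto
  also have "\<dots> = emeasure lborel ((+) c -` (A - E)) + emeasure lborel ((+) (- c) -` (A \<inter> E))"
    unfolding eq by (rule plus_emeasure[OF m dis, symmetric])
  also have "\<dots> = emeasure lborel (A - E) + emeasure lborel (A \<inter> E)"
    by (intro arg_cong2[where f = "(+)"] emeasure_lborel_vimage_plus sets.Diff sets.Int A(1) E)
  also have "\<dots> = emeasure lborel ((A - E) \<union> (A \<inter> E))"
    using A(1) by (subst plus_emeasure) auto
  also have "(A - E) \<union> (A \<inter> E) = A" by blast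
  also have "emeasure lborel A = emeasure cubeM A"
    using A by (subst emeasure_restrict_space) auto
  finally show "emeasure (distr cubeM cubeM (flip j k)) A = emeasure cubeM A" .
qed auto

lemma integral_flip:
  fixes g :: "real ^ 'n::finite \<Rightarrow> real"
  assumes "g \<in> borel_measurable borel"
  shows "(\<integral>x. g (flip j k x) \<partial>cubeM) = (\<integral>x. g x \<partial>cubeM)"
  using integral_distr[OF flip_measurable borel_measurable_cubeM[OF assms], of j k]
  by (simp add: flip_measure_preserving)

lemma integral_flip_odd:
  fixes g :: "real ^ 'n::finite \<Rightarrow> real"
  assumes "g \<in> borel_measurable borel" "\<And>x. g (flip j k x) = - g x"
  shows "(\<integral>x. g x \<partial>cubeM) = 0"
  using integral_flip[OF assms(1), of j k] by (simp add: assms(2))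

section \<open>Orthogonality against the discrepancy function\<close>

definition same_cell :: "('n \<Rightarrow> nat) \<Rightarrow> real ^ 'n \<Rightarrow> real ^ 'n \<Rightarrow> bool" where
  "same_cell r p x \<longleftrightarrow> (\<forall>j. \<lfloor>2 ^ r j * p $ j\<rfloor> = \<lfloor>2 ^ r j * x $ j\<rfloor>)"

text \<open>On a dyadic box without points the counting part of the discrepancy function is orthogonal
  to the Haar function of the box, so only the volume part is seen there.\<close>
definition free_ind :: "(real ^ 'n) set \<Rightarrow> ('n \<Rightarrow> nat) \<Rightarrow> real ^ 'n \<Rightarrow> real" where
  "free_ind P r x = (if \<exists>p\<in>P. same_cell r p x then 0 else 1)"

definition roth_fun :: "(real ^ 'n) set \<Rightarrow> ('n \<Rightarrow> nat) \<Rightarrow> real ^ 'n \<Rightarrow> real" where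
  "roth_fun P r x = free_ind P r x * (\<Prod>j\<in>UNIV. rademacher (r j) (x $ j))"

lemma same_cell_flip: "r j \<le> l \<Longrightarrow> same_cell r p (flip j l x) \<longleftrightarrow> same_cell r p x"
  unfolding same_cell_def flip_nth by (rule iff_allI) (simp add: floor_sflip_coarse)

lemma free_ind_flip: "r j \<le> l \<Longrightarrow> free_ind P r (flip j l x) = free_ind P r x"
  by (simp add: free_ind_def same_cell_flip del: flip_nth)

lemma prod_rademacher_flip:
  fixes x :: "real ^ 'n::finite"
  shows "(\<Prod>i\<in>UNIV. rademacher (r i) (flip j (r j) x $ i)) = - (\<Prod>i\<in>UNIV. rademacher (r i) (x $ i))"
proof -
  have "(\<Prod>i\<in>UNIV. rademacher (r i) (flip j (r j) x $ i))
      = (\<Prod>i\<in>UNIV. (if i = j then -1 else 1) * rademacher (r i) (x $ i))"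
    by (intro prod.cong) (auto simp: rademacher_sflip)
  thus ?thesis by (simp add: prod.distrib)
qed

text \<open>This and \<open>roth_fun_flip_fine\<close> supply the hypotheses \<open>odd\<close> and
  \<open>inv\<close> of \<open>hyperbolic_sum_moment\<close>. The factor \<open>free_ind\<close>
  does not interfere, being constant on cells of shape \<open>r\<close>.\<close>

lemma roth_fun_flip: "roth_fun P r (flip j (r j) x) = - roth_fun P r (x :: real ^ 'n::finite)"
  unfolding roth_fun_def by (simp add: prod_rademacher_flip free_ind_flip del: flip_nth)

lemma roth_fun_flip_fine:
  assumes "r j < l"
  shows "roth_fun P r (flip j l x) = roth_fun P r (x :: real ^ 'n::finite)"
proof -
  have "(\<Prod>i\<in>UNIV. rademacher (r i) (flip j l x $ i)) = (\<Prod>i\<in>UNIV. rademacher (r i) (x $ i))"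
    using assms by (intro prod.cong) (auto simp: rademacher_sflip_fine)
  thus ?thesis using assms by (simp add: roth_fun_def free_ind_flip del: flip_nth)
qed

lemma abs_roth_fun_le: "\<bar>roth_fun P r (x :: real ^ 'n::finite)\<bar> \<le> 1"
  by (simp add: roth_fun_def abs_mult abs_prod abs_rademacher free_ind_def)

lemma rademacher_measurable [measurable]: "rademacher k \<in> borel_measurable borel"
  unfolding rademacher_def[abs_def] by measurable

lemma same_cell_measurable [measurable]:
  "Measurable.pred borel (\<lambda>x::real ^ 'n::finite. same_cell r p x)"
  unfolding same_cell_def by measurable

lemma free_ind_measurable [measurable]:
  "finite P \<Longrightarrow> (free_ind P r :: real ^ 'n::finite \<Rightarrow> real) \<in> borel_measurable borel"
  unfolding free_ind_def[abs_def] by measurable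

lemma roth_fun_measurable [measurable]:
  "finite P \<Longrightarrow> (roth_fun P r :: real ^ 'n::finite \<Rightarrow> real) \<in> borel_measurable borel"
  unfolding roth_fun_def[abs_def] by measurable

lemma integrable_cubeM:
  fixes f :: "real ^ 'n::finite \<Rightarrow> real"
  assumes "f \<in> borel_measurable borel" "\<And>x. x \<in> ucube \<Longrightarrow> \<bar>f x\<bar> \<le> B"
  shows "integrable cubeM f"
  using assms borel_measurable_cubeM finite_measure_cubeM
  by (intro finite_measure.integrable_const_bound[of cubeM f B]) (auto simp: space_restrict_space)

lemma integral_roth_fun_corner:
  fixes p :: "real ^ 'n::finite"
  assumes P: "finite P" "p \<in> P"
  shows "(\<integral>x. roth_fun P r x * (if \<forall>j. p $ j < x $ j then 1 else 0) \<partial>cubeM) = 0"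
proof -
  (* p and x lie in different cells, and in a coordinate j where the cells differ the condition
     p $ j < x $ j is unaffected by flip j (r j). *)
  define e :: "'n set \<Rightarrow> real ^ 'n \<Rightarrow> real"
    where "e J x = (if \<forall>j\<in>J. \<lfloor>2 ^ r j * p $ j\<rfloor> = \<lfloor>2 ^ r j * x $ j\<rfloor> then 1 else 0)" for J x
  define g where "g x = roth_fun P r x * (if \<forall>j. p $ j < x $ j then 1 else 0)" for x
  have [measurable]: "e J \<in> borel_measurable borel" for J
    unfolding e_def[abs_def] by measurable
  have [measurable]: "g \<in> borel_measurable borel"
    unfolding g_def[abs_def] using P by measurable
  have gb: "\<bar>g x\<bar> \<le> 1" for x
    unfolding g_def using abs_roth_fun_le[of P r x] by auto
  have eb: "\<bar>e J x\<bar> \<le> 1" "\<bar>1 - e J x\<bar> \<le> 1" for J x by (auto simp: e_def)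
  \<comment> \<open>The factor \<open>1 - e J x\<close> indicates that the cells of \<open>p\<close>
    and \<open>x\<close> differ in some coordinate of \<open>J\<close>. Adding \<open>j\<close>
    contributes the part where they differ at \<open>j\<close> but agree on \<open>J\<close>, and
    there the integrand is odd under \<open>flip j (r j)\<close>.\<close>
  have "(\<integral>x. g x * (1 - e J x) \<partial>cubeM) = 0" if "finite J" for J
    using that
  proof induction
    case empty
    show ?case by (simp add: e_def)
  next
    case (insert j J)
    have "e (insert j J) x = e J x * e {j} x" for x by (auto simp: e_def)
    hence eq: "g x * (1 - e (insert j J) x) = g x * (1 - e J x) + g x * (e J x * (1 - e {j} x))" for x
      by (simp add: algebra_simps)
    have "(\<integral>x. g x * (e J x * (1 - e {j} x)) \<partial>cubeM) = 0"
    proof (rule integral_flip_odd)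
      fix x :: "real ^ 'n"
      have 1: "e L (flip j (r j) x) = e L x" for L
        unfolding e_def by (intro if_cong ball_cong refl) (auto simp: floor_sflip_coarse)
      have 2: "g (flip j (r j) x) = - g x" if ne: "\<lfloor>2 ^ r j * p $ j\<rfloor> \<noteq> \<lfloor>2 ^ r j * x $ j\<rfloor>"
      proof -
        \<comment> \<open>Points in different cells are ordered as their cells are, and the flip
          does not leave the cell.\<close>
        have lt: "p $ j < y \<longleftrightarrow> \<lfloor>2 ^ r j * p $ j\<rfloor> < \<lfloor>2 ^ r j * y\<rfloor>"
          if "\<lfloor>2 ^ r j * p $ j\<rfloor> \<noteq> \<lfloor>2 ^ r j * y\<rfloor>" for y
        proof
          assume "p $ j < y"
          hence "2 ^ r j * p $ j \<le> 2 ^ r j * y" by simp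
          hence "\<lfloor>2 ^ r j * p $ j\<rfloor> \<le> \<lfloor>2 ^ r j * y\<rfloor>" by (rule floor_mono)
          thus "\<lfloor>2 ^ r j * p $ j\<rfloor> < \<lfloor>2 ^ r j * y\<rfloor>" using that by simp
        next
          assume "\<lfloor>2 ^ r j * p $ j\<rfloor> < \<lfloor>2 ^ r j * y\<rfloor>"
          hence "2 ^ r j * p $ j < 2 ^ r j * y" by (metis floor_less_cancel)
          thus "p $ j < y" by simp
        qed
        have "p $ j < sflip (r j) (x $ j) \<longleftrightarrow> p $ j < x $ j"
          using lt[of "x $ j"] lt[of "sflip (r j) (x $ j)"] ne by (simp add: floor_sflip_coarse)
        hence "(\<forall>i. p $ i < flip j (r j) x $ i) \<longleftrightarrow> (\<forall>i. p $ i < x $ i)"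
          by (intro iff_allI) auto
        thus ?thesis unfolding g_def by (simp add: roth_fun_flip del: flip_nth)
      qed
      show "g (flip j (r j) x) * (e J (flip j (r j) x) * (1 - e {j} (flip j (r j) x)))
        = - (g x * (e J x * (1 - e {j} x)))"
        unfolding 1 using 2 by (cases "\<lfloor>2 ^ r j * p $ j\<rfloor> = \<lfloor>2 ^ r j * x $ j\<rfloor>") (auto simp: e_def)
    qed measurable
    moreover have "integrable cubeM (\<lambda>x. g x * (1 - e J x))"
      by (rule integrable_cubeM[where B = "1 * 1"], measurable)
         (unfold abs_mult, intro mult_mono gb eb, auto)
    moreover have "integrable cubeM (\<lambda>x. g x * (e J x * (1 - e {j} x)))"
      by (rule integrable_cubeM[where B = "1 * (1 * 1)"], measurable)
         (unfold abs_mult, intro mult_mono gb eb, auto)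
    ultimately show ?case unfolding eq using insert.IH by simp
  qed
  from this[of UNIV] have "(\<integral>x. g x * (1 - e UNIV x) \<partial>cubeM) = 0" by simp
  \<comment> \<open>Where \<open>e UNIV x\<close> is 1, \<open>x\<close> shares the cell of
    \<open>p\<close> and \<open>roth_fun\<close> vanishes.\<close>
  moreover have "g x * (1 - e UNIV x) = g x" for x
    using P(2) by (auto simp: g_def e_def roth_fun_def free_ind_def same_cell_def)
  ultimately show ?thesis unfolding g_def by simp
qed

text \<open>Coordinates are treated one at a time: in \<open>w J\<close> the factors belonging to
  \<open>J\<close> have been replaced by their mean over the orbits of \<open>flip j (r j)\<close>.
  By \<open>rademacher_mean\<close> the two values add up to \<open>1 / 2 ^ (r j + 1)\<close>, so
  the mean is \<open>1 / 2 ^ (r j + 2)\<close>. All other factors are invariant under that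
  flip.\<close>

lemma integral_roth_fun_volume:
  assumes P: "finite (P :: (real ^ 'n::finite) set)"
  shows "(\<integral>x. roth_fun P r x * (\<Prod>j\<in>UNIV. x $ j) \<partial>cubeM)
    = (\<Prod>j\<in>UNIV. 1 / 2 ^ (r j + 2)) * (\<integral>x. free_ind P r x \<partial>cubeM)"
proof -
  define w where "w J x = free_ind P r x * (\<Prod>j\<in>J. 1 / 2 ^ (r j + 2))
      * (\<Prod>j\<in>-J. x $ j * rademacher (r j) (x $ j))" for J :: "'n set" and x
  have [measurable]: "w J \<in> borel_measurable borel" for J
    unfolding w_def[abs_def] using P by measurable
  have "(\<integral>x. w J x \<partial>cubeM) = (\<integral>x. w {} x \<partial>cubeM)" if "finite J" for J
    using that
  proof induction
    case (insert j J)
    define v where "v x = free_ind P r x * (\<Prod>j\<in>J. 1 / 2 ^ (r j + 2))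
      * (\<Prod>j\<in>-(insert j J). x $ j * rademacher (r j) (x $ j))" for x
    have [measurable]: "v \<in> borel_measurable borel"
      unfolding v_def[abs_def] using P by measurable
    have hp: "(1::real) \<le> 4 * 2 ^ k" for k
      using one_le_power[of "2::real" k] by linarith
    have vb: "\<bar>v x\<bar> \<le> 1" if "x \<in> ucube" for x
    proof -
      have "\<bar>\<Prod>j\<in>J. 1 / 2 ^ (r j + 2) :: real\<bar> \<le> 1"
        by (auto simp: abs_prod field_simps hp intro!: prod_le_1)
      moreover have "\<bar>\<Prod>j\<in>-(insert j J). x $ j * rademacher (r j) (x $ j)\<bar> \<le> 1"
        using that by (auto simp: abs_prod abs_mult abs_rademacher ucube_def less_imp_le intro!: prod_le_1)
      moreover have "\<bar>free_ind P r x\<bar> \<le> 1" by (simp add: free_ind_def)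
      ultimately have "\<bar>v x\<bar> \<le> 1 * 1 * 1"
        unfolding v_def abs_mult by (intro mult_mono) auto
      thus ?thesis by simp
    qed
    have vflip: "v (flip j (r j) x) = v x" for x
    proof -
      have "(\<Prod>i\<in>-(insert j J). flip j (r j) x $ i * rademacher (r i) (flip j (r j) x $ i))
          = (\<Prod>i\<in>-(insert j J). x $ i * rademacher (r i) (x $ i))"
        by (intro prod.cong) auto
      thus ?thesis unfolding v_def by (simp add: free_ind_flip del: flip_nth)
    qed
    have c: "- J = insert j (- insert j J)" using insert.hyps by blast
    have wJ: "w J x = v x * (x $ j * rademacher (r j) (x $ j))" for x
      unfolding w_def v_def by (subst c) (simp add: mult_ac)
    have wj: "w (insert j J) x = v x * (1 / 2 ^ (r j + 2))" for x
      unfolding w_def v_def using insert.hyps by (simp add: mult_ac)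
    have int: "integrable cubeM (w J)"
    proof (rule integrable_cubeM[where B = 1])
      fix x :: "real ^ 'n" assume x: "x \<in> ucube"
      hence "\<bar>x $ j\<bar> \<le> 1" by (auto simp: ucube_def less_imp_le)
      hence "\<bar>w J x\<bar> \<le> 1 * (1 * 1)"
        unfolding wJ abs_mult abs_rademacher by (intro mult_mono vb x) auto
      thus "\<bar>w J x\<bar> \<le> 1" by simp
    qed measurable
    have int': "integrable cubeM (\<lambda>x. w J (flip j (r j) x))"
      using integrable_distr[OF flip_measurable[of j "r j"], of "w J"] int
      by (simp add: flip_measure_preserving)
    have "2 * (\<integral>x. w J x \<partial>cubeM) = (\<integral>x. w J x \<partial>cubeM) + (\<integral>x. w J (flip j (r j) x) \<partial>cubeM)"
      by (simp add: integral_flip)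
    also have "\<dots> = (\<integral>x. w J x + w J (flip j (r j) x) \<partial>cubeM)"
      using int int' by simp
    also have "\<dots> = (\<integral>x. 2 * w (insert j J) x \<partial>cubeM)"
    proof (rule Bochner_Integration.integral_cong[OF refl])
      fix x :: "real ^ 'n"
      have "w J x + w J (flip j (r j) x)
         = v x * (x $ j * rademacher (r j) (x $ j) + sflip (r j) (x $ j) * rademacher (r j) (sflip (r j) (x $ j)))"
        unfolding wJ vflip by (simp add: distrib_left)
      thus "w J x + w J (flip j (r j) x) = 2 * w (insert j J) x"
        unfolding rademacher_mean wj by simp
    qed
    finally show ?case using insert.IH by simp
  qed simp
  from this[of UNIV] have "(\<integral>x. w {} x \<partial>cubeM) = (\<integral>x. w UNIV x \<partial>cubeM)" by simp
  moreover have "w {} x = roth_fun P r x * (\<Prod>j\<in>UNIV. x $ j)" for x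
    unfolding w_def roth_fun_def by (simp add: prod.distrib)
  moreover have "w UNIV x = (\<Prod>j\<in>UNIV. 1 / 2 ^ (r j + 2)) * free_ind P r x" for x
    unfolding w_def by simp
  ultimately show ?thesis by simp
qed

text \<open>Equality can fail because the cell of \<open>p\<close> may lie outside
  \<open>ucube\<close>, for instance when a coordinate of \<open>p\<close> is 1.\<close>

lemma measure_cell_le:
  fixes p :: "real ^ 'n::finite"
  shows "(\<integral>x. (if same_cell r p x then 1 else 0) \<partial>cubeM) \<le> (1::real) / 2 ^ (\<Sum>j\<in>UNIV. r j)"
proof -
  define a b :: "real ^ 'n"
    where "a = (\<chi> j. \<lfloor>2 ^ r j * p $ j\<rfloor> / 2 ^ r j)"
      and "b = (\<chi> j. \<lfloor>2 ^ r j * p $ j\<rfloor> / 2 ^ r j + 1 / 2 ^ r j)"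
  define S where "S = {x. same_cell r p x} \<inter> ucube"
  have [measurable]: "S \<in> sets borel" unfolding S_def by measurable
  have sub: "S \<subseteq> cbox a b"
  proof
    fix x assume "x \<in> S"
    hence "\<lfloor>2 ^ r j * p $ j\<rfloor> = \<lfloor>2 ^ r j * x $ j\<rfloor>" for j by (auto simp: S_def same_cell_def)
    hence "real_of_int \<lfloor>2 ^ r j * p $ j\<rfloor> \<le> 2 ^ r j * x $ j"
       "2 ^ r j * x $ j \<le> real_of_int \<lfloor>2 ^ r j * p $ j\<rfloor> + 1" for j
      by (metis of_int_floor_le, metis real_of_int_floor_add_one_ge)
    thus "x \<in> cbox a b" by (auto simp: mem_box_cart a_def b_def field_simps)
  qed
  have "(\<integral>x. (if same_cell r p x then 1 else 0) \<partial>cubeM) 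
    = (\<integral>x. indicator ucube x *\<^sub>R (if same_cell r p x then 1 else 0) \<partial>lborel :: real)"
    by (subst Bochner_Integration.integral_restrict_space) auto
  also have "\<dots> = (\<integral>x. indicator S x \<partial>lborel :: real)"
    by (rule Bochner_Integration.integral_cong) (auto simp: S_def indicator_def)
  also have "\<dots> = measure lborel S" by simp
  also have "\<dots> \<le> measure lborel (cbox a b)"
    using sub by (intro measure_mono_fmeasurable) (auto simp: fmeasurable_cbox)
  also have "\<dots> = (\<Prod>j\<in>UNIV. 1 / 2 ^ r j)"
  proof -
    have "a \<in> cbox a b" by (simp add: mem_box_cart a_def b_def)
    hence "cbox a b \<noteq> {}" by blast
    thus ?thesis by (simp add: content_cbox_cart a_def b_def)
  qed
  also have "\<dots> = 1 / 2 ^ (\<Sum>j\<in>UNIV. r j)"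
    by (simp add: prod_dividef power_sum)
  finally show ?thesis .
qed

text \<open>A union bound over the cells of the points.\<close>

lemma integral_free_ind_ge:
  assumes P: "finite (P :: (real ^ 'n::finite) set)"
  shows "1 - real (card P) / 2 ^ (\<Sum>j\<in>UNIV. r j) \<le> (\<integral>x. free_ind P r x \<partial>cubeM)"
proof -
  interpret finite_measure "cubeM :: (real ^ 'n) measure" by (rule finite_measure_cubeM)
  have ic: "integrable cubeM (\<lambda>x. (if same_cell r p x then 1 else 0) :: real)" for p :: "real ^ 'n"
    by (rule integrable_cubeM[where B = 1]) auto
  have one: "(\<integral>x. 1 \<partial>(cubeM :: (real ^ 'n) measure)) = (1 :: real)"
    by (simp add: measure_cubeM)
  have "(\<Sum>p\<in>P. (\<integral>x. (if same_cell r p x then 1 else 0) \<partial>cubeM)) \<le> (\<Sum>p\<in>P. 1 / 2 ^ (\<Sum>j\<in>UNIV. r j) :: real)"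
    by (intro sum_mono measure_cell_le)
  hence "1 - real (card P) / 2 ^ (\<Sum>j\<in>UNIV. r j)
     \<le> 1 - (\<Sum>p\<in>P. (\<integral>x. (if same_cell r p x then 1 else 0) \<partial>cubeM))" by simp
  also have "\<dots> = (\<integral>x. 1 - (\<Sum>p\<in>P. if same_cell r p x then 1 else 0) \<partial>cubeM)"
    using ic one by (subst Bochner_Integration.integral_diff) auto
  also have "\<dots> \<le> (\<integral>x. free_ind P r x \<partial>cubeM)"
  proof (rule integral_mono)
    show "integrable cubeM (\<lambda>x. 1 - (\<Sum>p\<in>P. if same_cell r p x then 1 else 0) :: real)"
      using ic by auto
    show "integrable cubeM (free_ind P r)"
      using P by (intro integrable_cubeM[where B = 1]) (auto simp: free_ind_def)
    fix x :: "real ^ 'n"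
    show "1 - (\<Sum>p\<in>P. if same_cell r p x then 1 else 0) \<le> free_ind P r x"
    proof (cases "\<exists>p\<in>P. same_cell r p x")
      case True
      then obtain p where "p \<in> P" "same_cell r p x" by blast
      hence "1 \<le> (\<Sum>p\<in>P. if same_cell r p x then 1 else 0 :: real)"
        using P member_le_sum[of p P "\<lambda>p. if same_cell r p x then 1 else 0 :: real"] by auto
      thus ?thesis using True by (simp add: free_ind_def)
    next
      case False
      hence "(\<Sum>p\<in>P. if same_cell r p x then 1 else 0 :: real) = 0" by (intro sum.neutral) auto
      thus ?thesis using False by (simp add: free_ind_def)
    qed
  qed
  finally show ?thesis .
qed

section \<open>The discrepancy function on the cube and its pairing with
  \<open>roth_fun\<close>\<close>

lemma measure_origin_box:
  fixes x :: "real ^ 'n::finite"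
  assumes "\<And>j. 0 \<le> x $ j"
  shows "measure lborel (origin_box x) = (\<Prod>j\<in>UNIV. x $ j)"
proof -
  have [measurable]: "origin_box x \<in> sets borel" unfolding origin_box_def by measurable
  have "cbox 0 x \<noteq> {}" using assms by (auto simp: interval_ne_empty_cart)
  hence c: "measure lborel (cbox 0 x) = (\<Prod>j\<in>UNIV. x $ j)" by (simp add: content_cbox_cart)
  have "measure lborel (origin_box x) \<le> measure lborel (cbox 0 x)"
    by (intro measure_mono_fmeasurable) (auto simp: origin_box_def mem_box_cart less_imp_le)
  moreover have "measure lborel (box 0 x) \<le> measure lborel (origin_box x)"
  proof (rule measure_mono_fmeasurable)
    show "origin_box x \<in> fmeasurable lborel"
      by (rule fmeasurableI2[of "cbox 0 x"]) (auto simp: origin_box_def mem_box_cart less_imp_le)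
  qed (auto simp: origin_box_def mem_box_cart less_imp_le)
  moreover have "measure lborel (box 0 x) = measure lborel (cbox 0 x)"
    by (simp only: measure_lborel_box_eq measure_lborel_cbox_eq)
  ultimately show ?thesis using c by linarith
qed

text \<open>The discrepancy function off the cube involves the volume of \<open>origin_box\<close> in all octants; this
  Borel function agrees with it on the cube.\<close>
definition disc :: "(real ^ 'n) set \<Rightarrow> real ^ 'n \<Rightarrow> real" where
  "disc P x = (\<Sum>p\<in>P. if \<forall>j. p $ j < x $ j then 1 else 0) - real (card P) * (\<Prod>j\<in>UNIV. x $ j)"

lemma discrepancy_eq_disc:
  fixes x :: "real ^ 'n::finite"
  assumes "finite P" "P \<subseteq> cbox 0 1" "x \<in> cbox 0 1"
  shows "discrepancy P x = disc P x"
proof -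
  have "P \<inter> origin_box x = {p \<in> P. \<forall>j. p $ j < x $ j}"
    using assms(2) by (auto simp: origin_box_def mem_box_cart)
  moreover have "measure lborel (origin_box x) = (\<Prod>j\<in>UNIV. x $ j)"
    using assms(3) by (intro measure_origin_box) (auto simp: mem_box_cart)
  ultimately show ?thesis
    using assms(1) by (simp add: discrepancy_def disc_def sum.If_cases Int_def)
qed

lemma disc_measurable [measurable]:
  "(disc P :: real ^ 'n::finite \<Rightarrow> real) \<in> borel_measurable borel"
  unfolding disc_def[abs_def] by measurable

lemma abs_disc_le:
  assumes "x \<in> ucube"
  shows "\<bar>disc P (x :: real ^ 'n::finite)\<bar> \<le> 2 * real (card P)"
proof -
  have "\<bar>\<Sum>p\<in>P. if \<forall>j. p $ j < x $ j then 1 else 0 :: real\<bar> \<le> (\<Sum>p\<in>P. 1)"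
    by (rule order_trans[OF sum_abs], rule sum_mono) auto
  moreover have "\<bar>\<Prod>j\<in>UNIV. x $ j\<bar> \<le> 1"
    using assms by (auto simp: abs_prod ucube_def less_imp_le intro!: prod_le_1)
  hence "\<bar>real (card P) * (\<Prod>j\<in>UNIV. x $ j)\<bar> \<le> real (card P)"
    by (simp add: abs_mult mult_left_le)
  ultimately show ?thesis unfolding disc_def by simp
qed

lemma set_integral_cbox_eq_cubeM:
  fixes g :: "real ^ 'n::finite \<Rightarrow> real"
  assumes [measurable]: "g \<in> borel_measurable borel"
  shows "(LINT x:cbox 0 1|lborel. g x) = (\<integral>x. g x \<partial>cubeM)"
proof -
  let ?N = "cbox 0 1 - ucube :: (real ^ 'n) set"
  have sub: "ucube \<subseteq> (cbox 0 1 :: (real ^ 'n) set)"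
    by (auto simp: ucube_def mem_box_cart less_imp_le)
  have one: "emeasure lborel (cbox 0 (1::real ^ 'n)) = 1"
    by (auto simp: emeasure_lborel_cbox_eq Basis_vec_def inner_axis intro!: prod.neutral)
  have "emeasure lborel ?N = emeasure lborel (cbox 0 (1::real ^ 'n)) - emeasure lborel (ucube :: (real ^ 'n) set)"
    using sub by (intro emeasure_Diff) (auto simp: emeasure_lborel_ucube)
  also have "\<dots> = 0"
    unfolding emeasure_lborel_ucube one by simp
  finally have "AE x in lborel. x \<notin> ?N" by (intro AE_not_in) (auto simp: null_sets_def)
  hence "(\<integral>x. indicator (cbox 0 1) x *\<^sub>R g x \<partial>lborel) = (\<integral>x. indicator ucube x *\<^sub>R g x \<partial>lborel)"
    using sub by (intro integral_cong_AE) (auto simp: indicator_def elim!: eventually_mono)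
  thus ?thesis
    unfolding set_lebesgue_integral_def by (subst integral_restrict_space) auto
qed

lemma Lp_norm_cube_discrepancy:
  fixes P :: "(real ^ 'n::finite) set"
  assumes "finite P" "P \<subseteq> cbox 0 1"
  shows "Lp_norm_cube p (discrepancy P) = (\<integral>x. \<bar>disc P x\<bar> powr p \<partial>cubeM) powr (1 / p)"
proof -
  have "(LINT x:cbox 0 1|lborel. \<bar>discrepancy P x\<bar> powr p) = (LINT x:cbox 0 1|lborel. \<bar>disc P x\<bar> powr p)"
    by (intro set_lebesgue_integral_cong) (auto simp: discrepancy_eq_disc[OF assms])
  thus ?thesis
    unfolding Lp_norm_cube_def by (subst set_integral_cbox_eq_cubeM[symmetric]) auto
qed

text \<open>The counting part integrates to zero and the volume part gives a multiple of
  \<open>N / 2 ^ n\<close> times the free volume. The two bounds on \<open>2 ^ n\<close> play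
  against each other: one leaves at least half of the cube free, the other keeps
  \<open>N / 2 ^ n\<close> at least 1/4. Their product is the 1/8.\<close>

lemma integral_disc_roth_fun_le:
  fixes P :: "(real ^ 'n::finite) set"
  assumes P: "finite P" and r: "(\<Sum>j\<in>UNIV. r j) = n"
    and n: "2 * card P \<le> 2 ^ n" "2 ^ n \<le> 4 * card P"
  shows "(\<integral>x. disc P x * roth_fun P r x \<partial>cubeM) \<le> - (1 / (8 * 4 ^ CARD('n)))"
proof -
  define N where "N = real (card P)"
  define I where "I = (\<integral>x. free_ind P r x \<partial>cubeM)"
  have int1: "integrable cubeM (\<lambda>x. roth_fun P r x * (if \<forall>j. p $ j < x $ j then 1 else 0))" for p :: "real ^ 'n"
    by (rule integrable_cubeM[where B = 1]) (use P abs_roth_fun_le[of P r] in auto)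
  have int2: "integrable cubeM (\<lambda>x. roth_fun P r x * (\<Prod>j\<in>UNIV. x $ j))"
  proof (rule integrable_cubeM[where B = "1 * 1"])
    fix x :: "real ^ 'n" assume x: "x \<in> ucube"
    have "\<bar>\<Prod>j\<in>UNIV. x $ j\<bar> \<le> 1"
      using x by (auto simp: abs_prod ucube_def less_imp_le intro!: prod_le_1)
    thus "\<bar>roth_fun P r x * (\<Prod>j\<in>UNIV. x $ j)\<bar> \<le> 1 * 1"
      unfolding abs_mult by (intro mult_mono abs_roth_fun_le) auto
  qed (use P in measurable)
  have "(\<integral>x. disc P x * roth_fun P r x \<partial>cubeM)
      = (\<integral>x. (\<Sum>p\<in>P. roth_fun P r x * (if \<forall>j. p $ j < x $ j then 1 else 0))
            - N * (roth_fun P r x * (\<Prod>j\<in>UNIV. x $ j)) \<partial>cubeM)"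
    unfolding disc_def N_def
    by (intro Bochner_Integration.integral_cong refl)
       (simp add: algebra_simps sum_distrib_left del: mult_if_delta)
  also have "\<dots> = (\<Sum>p\<in>P. \<integral>x. roth_fun P r x * (if \<forall>j. p $ j < x $ j then 1 else 0) \<partial>cubeM)
       - N * (\<integral>x. roth_fun P r x * (\<Prod>j\<in>UNIV. x $ j) \<partial>cubeM)"
    using int1 int2 by (subst Bochner_Integration.integral_diff) (auto simp: Bochner_Integration.integral_sum)
  also have "\<dots> = - (N * ((\<Prod>j\<in>UNIV. 1 / 2 ^ (r j + 2)) * I))"
    using P integral_roth_fun_corner[OF P] by (simp add: integral_roth_fun_volume I_def)
  also have "(\<Prod>j\<in>UNIV. 1 / 2 ^ (r j + 2)) = 1 / (2 ^ n * (4::real) ^ CARD('n))"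
    by (simp add: prod_dividef power_add prod.distrib r[symmetric] power_sum mult.commute)
  finally have eq: "(\<integral>x. disc P x * roth_fun P r x \<partial>cubeM) = - (N / 2 ^ n * I / 4 ^ CARD('n))"
    by simp
  have "2 * N \<le> 2 ^ n" "2 ^ n \<le> 4 * N"
    using n unfolding N_def by (metis of_nat_le_iff of_nat_mult of_nat_numeral of_nat_power)+
  hence q: "N / 2 ^ n \<le> 1 / 2" "1 / 4 \<le> N / 2 ^ n" by (simp_all add: field_simps)
  have "1 - N / 2 ^ n \<le> I"
    using integral_free_ind_ge[OF P, of r] unfolding r N_def I_def .
  hence "1 / 2 \<le> I" using q by linarith
  hence "1 / 4 * (1 / 2) \<le> N / 2 ^ n * I" using q by (intro mult_mono) auto
  hence "1 / 8 / 4 ^ CARD('n) \<le> N / 2 ^ n * I / (4 :: real) ^ CARD('n)"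
    by (intro divide_right_mono) auto
  thus ?thesis unfolding eq by simp
qed

section \<open>Choice of scales and a pointwise truncation inequality\<close>

lemma hyperbolic_index_set:
  fixes j0 :: "'n::finite" and n :: nat
  defines "K \<equiv> UNIV - {j0}" and "Q \<equiv> n div CARD('n) + 1"
  obtains A :: "('n \<Rightarrow> nat) set" where "finite A" "card A = Q ^ (CARD('n) - 1)"
    "inj_on (\<lambda>r. restrict r K) A" "\<And>r. r \<in> A \<Longrightarrow> (\<Sum>j\<in>UNIV. r j) = n"
proof -
  define S where "S = PiE K (\<lambda>_. {..<Q})"
  \<comment> \<open>The coordinates other than \<open>j0\<close> range freely up to
    \<open>n div CARD('n)\<close>, so their sum is at most \<open>n\<close>; the coordinate
    \<open>j0\<close> takes the rest, and the natural subtraction is exact.\<close>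
  define ext where "ext s = (\<lambda>j. if j = j0 then n - (\<Sum>i\<in>K. s i) else s j)" for s :: "'n \<Rightarrow> nat"
  have card_K: "card K = CARD('n) - 1" unfolding K_def by simp
  have res: "restrict (ext s) K = s" if "s \<in> S" for s
    using that by (auto simp: S_def K_def ext_def PiE_def extensional_def restrict_def)
  have inj: "inj_on ext S" by (rule inj_on_inverseI[where g = "\<lambda>r. restrict r K"]) (rule res)
  have sum_ext: "(\<Sum>j\<in>UNIV. ext s j) = n" if "s \<in> S" for s
  proof -
    have "(\<Sum>i\<in>K. s i) \<le> (\<Sum>i\<in>K. n div CARD('n))"
      using that by (intro sum_mono) (auto simp: S_def Q_def PiE_def Pi_def)
    also have "\<dots> \<le> CARD('n) * (n div CARD('n))" by (simp add: card_K)
    also have "\<dots> \<le> n" by simp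
    finally have le: "(\<Sum>i\<in>K. s i) \<le> n" .
    have "(\<Sum>j\<in>UNIV. ext s j) = ext s j0 + (\<Sum>j\<in>K. ext s j)"
      unfolding K_def by (rule sum.remove) auto
    also have "(\<Sum>j\<in>K. ext s j) = (\<Sum>j\<in>K. s j)"
      by (intro sum.cong) (auto simp: ext_def K_def)
    finally show ?thesis using le by (simp add: ext_def)
  qed
  show thesis
  proof (rule that[of "ext ` S"])
    show "finite (ext ` S)" unfolding S_def K_def by (intro finite_imageI finite_PiE) auto
    have "card S = Q ^ (CARD('n) - 1)"
      unfolding S_def by (subst card_PiE) (auto simp: card_K[unfolded K_def] K_def)
    thus "card (ext ` S) = Q ^ (CARD('n) - 1)" using inj by (simp add: card_image)
    show "inj_on (\<lambda>r. restrict r K) (ext ` S)" by (rule inj_onI) (auto simp: res)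
    show "\<And>r. r \<in> ext ` S \<Longrightarrow> (\<Sum>j\<in>UNIV. r j) = n" using sum_ext by auto
  qed
qed

text \<open>A pointwise substitute for truncation and Hoelder's inequality. If
  \<open>v \<le> K\<close>, the first term suffices; if \<open>v\<close> is at most
  \<open>\<epsilon> * u powr (p - 1)\<close>, the second does. Otherwise \<open>u\<close> is bounded
  by a power of \<open>v\<close>, the product is at most \<open>c * v powr q\<close> with
  \<open>q\<close> conjugate to \<open>p\<close>, and since \<open>M\<close> exceeds
  \<open>q\<close> the last term wins for large \<open>v\<close>.\<close>

lemma product_split_bound:
  fixes p \<epsilon> :: real
  assumes p: "1 < p" and \<epsilon>: "0 < \<epsilon>" and M: "p / (p - 1) < real M"
  obtains K where "0 < K" "\<And>u v. 0 \<le> u \<Longrightarrow> 0 \<le> v \<Longrightarrow> u * v \<le> K * u + \<epsilon> * u powr p + \<epsilon> * v ^ M"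
proof -
  define q where "q = p / (p - 1)"
  define c where "c = (1 / \<epsilon>) powr (1 / (p - 1))"
  \<comment> \<open>The threshold beyond which \<open>c * v powr q\<close> is at most
    \<open>\<epsilon> * v ^ M\<close>.\<close>
  define K where "K = (c / \<epsilon>) powr (1 / (real M - q))"
  have c: "0 < c" using \<epsilon> by (simp add: c_def)
  have K: "0 < K" using \<epsilon> c by (simp add: K_def)
  have Kq: "K powr (real M - q) = c / \<epsilon>"
    using M \<epsilon> c by (simp add: K_def powr_powr q_def)
  have "u * v \<le> K * u + \<epsilon> * u powr p + \<epsilon> * v ^ M" if u: "0 \<le> u" and v: "0 \<le> v" for u v
  proof -
    have nn: "0 \<le> K * u" "0 \<le> \<epsilon> * u powr p" "0 \<le> \<epsilon> * v ^ M" using K \<epsilon> u v by auto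
    consider "v \<le> K" | "K < v" "u = 0" | "K < v" "0 < u" "v / \<epsilon> \<le> u powr (p - 1)"
      | "K < v" "0 < u" "u powr (p - 1) < v / \<epsilon>" using u by linarith
    thus ?thesis
    proof cases
      case 1
      hence "v * u \<le> K * u" using u by (intro mult_right_mono)
      with nn show ?thesis by (simp add: mult.commute)
    next
      case 2
      with nn show ?thesis by simp
    next
      case 3
      hence "v \<le> \<epsilon> * u powr (p - 1)" using \<epsilon> by (simp add: field_simps)
      hence "u * v \<le> u * (\<epsilon> * u powr (p - 1))" using u by (intro mult_left_mono)
      also have "\<dots> = \<epsilon> * u powr p"
        using 3(2) by (simp add: powr_diff)
      finally show ?thesis using nn by linarith
    next
      case 4
      have v0: "0 < v" using 4 K by linarith
      have "u = (u powr (p - 1)) powr (1 / (p - 1))"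
        using 4 p by (simp add: powr_powr)
      also have "\<dots> \<le> (v / \<epsilon>) powr (1 / (p - 1))"
        using 4 p by (intro powr_mono2) auto
      also have "\<dots> = c * v powr (1 / (p - 1))"
        using v0 \<epsilon> powr_mult[of v "1 / \<epsilon>" "1 / (p - 1)"] by (simp add: c_def mult.commute)
      finally have "u * v \<le> c * v powr (1 / (p - 1)) * v"
        using v0 by (intro mult_right_mono) auto
      also have "\<dots> = c * v powr (1 / (p - 1) + 1)"
        using v0 by (simp add: powr_add)
      also have "1 / (p - 1) + 1 = q" using p by (simp add: q_def field_simps)
      also have "c * v powr q = \<epsilon> * (K powr (real M - q) * v powr q)"
        using \<epsilon> by (simp add: Kq)
      also have "\<dots> \<le> \<epsilon> * (v powr (real M - q) * v powr q)"
        using 4 K M \<epsilon> by (intro mult_left_mono mult_right_mono powr_mono2) (auto simp: q_def)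
      also have "\<dots> = \<epsilon> * v ^ M"
        using v0 by (simp add: powr_add[symmetric] powr_realpow)
      finally show ?thesis using nn by linarith
    qed
  qed
  thus thesis using K that by blast
qed

section \<open>The lower bound\<close>

text \<open>The size is measured by \<open>n div CARD('n) + 1\<close> rather than by a logarithm
  because the square of the resulting normalisation \<open>s\<close> is then exactly the number of
  scales.\<close>

lemma disc_L1_lower_bound:
  fixes p :: real
  assumes p: "1 < p" and Cp: "0 < Cp"
  obtains c where "0 < c"
    "\<And>(P :: (real ^ 'n::finite) set) n. \<lbrakk>finite P; 2 * card P \<le> 2 ^ n; 2 ^ n \<le> 4 * card P;
       (\<integral>x. \<bar>disc P x\<bar> powr p \<partial>cubeM) \<le> Cp * (real (n div CARD('n) + 1) powr ((real CARD('n) - 1) / 2)) powr p\<rbrakk>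
      \<Longrightarrow> c * real (n div CARD('n) + 1) powr ((real CARD('n) - 1) / 2) \<le> (\<integral>x. \<bar>disc P x\<bar> \<partial>cubeM)"
proof -
  define d where "d = CARD('n)"
  define E where "E = (real d - 1) / 2"
  define c0 :: real where "c0 = 1 / (8 * 4 ^ d)"
  obtain m0 :: nat where "p / (p - 1) < real m0" using reals_Archimedean2 by blast
  then obtain m where m: "p / (p - 1) < real (2 * Suc m)"
    by (metis less_le_trans of_nat_le_iff le_Suc_eq le_add2 mult_2 trans_le_add1 order_trans)
  define Cm where "Cm = ((2 * burkholder_const m) ^ Suc m) ^ (d - 1)"
  have Cm: "0 < Cm" using burkholder_const_ge_1[of m] by (simp add: Cm_def)
  have c0: "0 < c0" by (simp add: c0_def)
  \<comment> \<open>Chosen so that the two error terms together take half of the lower bound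
    \<open>c0\<close>.\<close>
  define \<epsilon> where "\<epsilon> = c0 / (2 * (Cp + Cm))"
  have \<epsilon>: "0 < \<epsilon>" using c0 Cp Cm by (simp add: \<epsilon>_def)
  have \<epsilon>C: "\<epsilon> * Cp + \<epsilon> * Cm = c0 / 2"
  proof -
    have half: "c0 / (2 * x) * x = c0 / 2" if "0 < x" for x using that by simp
    have "\<epsilon> * Cp + \<epsilon> * Cm = \<epsilon> * (Cp + Cm)" by (simp add: distrib_left)
    also have "\<dots> = c0 / 2" using half[OF add_pos_pos[OF Cp Cm]] by (simp only: \<epsilon>_def)
    finally show ?thesis .
  qed
  obtain K where K: "0 < K"
    "\<And>u v. 0 \<le> u \<Longrightarrow> 0 \<le> v \<Longrightarrow> u * v \<le> K * u + \<epsilon> * u powr p + \<epsilon> * v ^ (2 * Suc m)"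
    using product_split_bound[OF p \<epsilon> m] by blast
  have main: "c0 / (2 * K) * real (n div d + 1) powr E \<le> (\<integral>x. \<bar>disc P x\<bar> \<partial>cubeM)"
    if P: "finite P" and n: "2 * card P \<le> 2 ^ n" "2 ^ n \<le> 4 * card P"
      and Lp: "(\<integral>x. \<bar>disc P x\<bar> powr p \<partial>cubeM) \<le> Cp * (real (n div d + 1) powr E) powr p"
    for P :: "(real ^ 'n) set" and n
  proof -
    interpret finite_measure "cubeM :: (real ^ 'n) measure" by (rule finite_measure_cubeM)
    define s where "s = real (n div d + 1) powr E"
    have s: "0 < s" by (simp add: s_def)
    obtain j0 :: 'n where True by simp
    obtain A :: "('n \<Rightarrow> nat) set" where A: "finite A" "card A = (n div d + 1) ^ (d - 1)"
      "inj_on (\<lambda>r. restrict r (UNIV - {j0})) A" "\<And>r. r \<in> A \<Longrightarrow> (\<Sum>j\<in>UNIV. r j) = n"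
      using hyperbolic_index_set[of n j0] unfolding d_def by blast
    have s2: "s\<^sup>2 = real (card A)"
    proof -
      have "s\<^sup>2 = real (n div d + 1) powr (E * 2)"
        by (simp add: s_def powr_powr flip: powr_numeral)
      also have "E * 2 = real (d - 1)" by (simp add: E_def d_def of_nat_diff Suc_leI)
      also have "real (n div d + 1) powr real (d - 1) = real (card A)"
        unfolding A(2) by (subst powr_realpow) auto
      finally show ?thesis .
    qed
    define F where "F x = (\<Sum>r\<in>A. roth_fun P r x)" for x
    have [measurable]: "F \<in> borel_measurable borel"
      unfolding F_def[abs_def] using P by measurable
    have Fb: "\<bar>F x\<bar> \<le> real (card A)" for x
    proof -
      have "\<bar>F x\<bar> \<le> (\<Sum>r\<in>A. 1)"
        unfolding F_def by (rule order_trans[OF sum_abs], rule sum_mono) (rule abs_roth_fun_le)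
      thus ?thesis by simp
    qed
    have moment: "(\<integral>x. F x ^ (2 * Suc m) \<partial>cubeM) \<le> Cm * s ^ (2 * Suc m)"
    proof -
      have B: "r j < n + 1" if "r \<in> A" for r j
        using A(4)[OF that] member_le_sum[of j UNIV r] by simp
      have "(\<integral>x. F x ^ (2 * Suc m) \<partial>cubeM)
        \<le> ((2 * burkholder_const m) ^ Suc m) ^ card (UNIV - {j0}) * (real (card A) ^ Suc m
            * measure cubeM (space (cubeM :: (real ^ 'n) measure)))"
        unfolding F_def
      proof (rule hyperbolic_sum_moment[where \<sigma> = flip and B = "n + 1" and K = "UNIV - {j0}"])
        show "\<And>r. r \<in> A \<Longrightarrow> roth_fun P r \<in> borel_measurable cubeM"
          using P by (intro borel_measurable_cubeM) measurable
      qed (use A(1,3) B in \<open>auto intro: finite_measure_cubeM flip_measurable flip_measure_preserving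
             abs_roth_fun_le roth_fun_flip roth_fun_flip_fine simp del: flip_nth\<close>)
      also have "\<dots> = Cm * s ^ (2 * Suc m)"
        unfolding space_cubeM measure_cubeM power_mult s2 Cm_def d_def by simp
      finally show ?thesis .
    qed
    define u where "u x = \<bar>disc P x\<bar> / s" for x
    define v where "v x = \<bar>F x\<bar> / s" for x
    have intD: "integrable cubeM (\<lambda>x. \<bar>disc P x\<bar>)"
      by (rule integrable_cubeM[where B = "2 * real (card P)"]) (use abs_disc_le in auto)
    have intDp: "integrable cubeM (\<lambda>x. \<bar>disc P x\<bar> powr p)"
    proof (rule integrable_cubeM[where B = "(2 * real (card P)) powr p"])
      fix x :: "real ^ 'n" assume "x \<in> ucube"
      thus "\<bar>\<bar>disc P x\<bar> powr p\<bar> \<le> (2 * real (card P)) powr p"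
        using p by (auto intro!: powr_mono2 abs_disc_le)
    qed measurable
    have intF: "integrable cubeM (\<lambda>x. F x ^ (2 * Suc m))"
    proof (rule integrable_cubeM[where B = "real (card A) ^ (2 * Suc m)"])
      fix x :: "real ^ 'n"
      show "\<bar>F x ^ (2 * Suc m)\<bar> \<le> real (card A) ^ (2 * Suc m)"
        unfolding power_abs by (intro power_mono Fb) auto
    qed measurable
    have intDr: "integrable cubeM (\<lambda>x. disc P x * roth_fun P r x)" for r
    proof (rule integrable_cubeM[where B = "2 * real (card P) * 1"])
      fix x :: "real ^ 'n" assume "x \<in> ucube"
      thus "\<bar>disc P x * roth_fun P r x\<bar> \<le> 2 * real (card P) * 1"
        unfolding abs_mult by (intro mult_mono abs_disc_le abs_roth_fun_le) auto
    qed (use P in measurable)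
    have DF: "disc P x * F x = (\<Sum>r\<in>A. disc P x * roth_fun P r x)" for x
      by (simp add: F_def sum_distrib_left)
    have intDF: "integrable cubeM (\<lambda>x. disc P x * F x)"
      unfolding DF using intDr by auto
    have "(\<integral>x. disc P x * F x \<partial>cubeM) = (\<Sum>r\<in>A. \<integral>x. disc P x * roth_fun P r x \<partial>cubeM)"
      unfolding DF using intDr by (subst Bochner_Integration.integral_sum) auto
    also have "\<dots> \<le> (\<Sum>r\<in>A. - c0)"
      unfolding c0_def d_def using n P A(4) by (intro sum_mono integral_disc_roth_fun_le) auto
    finally have low: "s\<^sup>2 * c0 \<le> - (\<integral>x. disc P x * F x \<partial>cubeM)" by (simp add: s2)
    \<comment> \<open>With \<open>D\<close> and \<open>F\<close> both divided by \<open>s\<close>,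
      their norms in \<open>L^p\<close> and \<open>L^(2m+2)\<close> are bounded independently of
      \<open>P\<close> and \<open>n\<close>, and the pairing stays at least \<open>c0\<close> in
      absolute value.\<close>
    have pw: "- (disc P x * F x) / s\<^sup>2 \<le> K * (\<bar>disc P x\<bar> / s) + \<epsilon> * (\<bar>disc P x\<bar> powr p / s powr p)
        + \<epsilon> * (F x ^ (2 * Suc m) / s ^ (2 * Suc m))" for x
    proof -
      have "- (disc P x * F x) / s\<^sup>2 \<le> \<bar>disc P x * F x\<bar> / s\<^sup>2"
        by (intro divide_right_mono) auto
      also have "\<dots> = u x * v x" by (simp add: u_def v_def abs_mult power2_eq_square)
      also have "\<dots> \<le> K * u x + \<epsilon> * u x powr p + \<epsilon> * v x ^ (2 * Suc m)"
        using s by (intro K) (auto simp: u_def v_def)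
      also have "u x powr p = \<bar>disc P x\<bar> powr p / s powr p"
        using s by (simp add: u_def powr_divide)
      also have "v x ^ (2 * Suc m) = F x ^ (2 * Suc m) / s ^ (2 * Suc m)"
        unfolding v_def power_divide by (simp add: power_mult)
      finally show ?thesis unfolding u_def .
    qed
    have "c0 \<le> - (\<integral>x. disc P x * F x \<partial>cubeM) / s\<^sup>2"
      using low s by (simp add: field_simps)
    also have "\<dots> = (\<integral>x. - (disc P x * F x) / s\<^sup>2 \<partial>cubeM)" by simp
    also have "\<dots> \<le> (\<integral>x. K * (\<bar>disc P x\<bar> / s) + \<epsilon> * (\<bar>disc P x\<bar> powr p / s powr p)
        + \<epsilon> * (F x ^ (2 * Suc m) / s ^ (2 * Suc m)) \<partial>cubeM)"
      by (intro integral_mono pw Bochner_Integration.integrable_add integrable_mult_right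
          integrable_divide Bochner_Integration.integrable_minus intD intDp intF intDF)
    also have "\<dots> = K * ((\<integral>x. \<bar>disc P x\<bar> \<partial>cubeM) / s)
        + \<epsilon> * ((\<integral>x. \<bar>disc P x\<bar> powr p \<partial>cubeM) / s powr p)
        + \<epsilon> * ((\<integral>x. F x ^ (2 * Suc m) \<partial>cubeM) / s ^ (2 * Suc m))"
      using intD intDp intF by (simp del: power_Suc mult_Suc_right)
    also have "\<dots> \<le> K * ((\<integral>x. \<bar>disc P x\<bar> \<partial>cubeM) / s) + \<epsilon> * Cp + \<epsilon> * Cm"
    proof (intro add_mono mult_left_mono order_refl)
      show "(\<integral>x. \<bar>disc P x\<bar> powr p \<partial>cubeM) / s powr p \<le> Cp"
        using Lp s unfolding s_def[symmetric] by (simp add: divide_le_eq)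
      show "(\<integral>x. F x ^ (2 * Suc m) \<partial>cubeM) / s ^ (2 * Suc m) \<le> Cm"
        using moment s by (simp add: divide_le_eq del: power_Suc mult_Suc_right)
    qed (use \<epsilon> K(1) in auto)
    finally have "c0 / 2 \<le> K * ((\<integral>x. \<bar>disc P x\<bar> \<partial>cubeM) / s)" using \<epsilon>C by linarith
    thus ?thesis using K(1) s unfolding s_def[symmetric] by (simp add: field_simps)
  qed
  show thesis
    by (rule that[of "c0 / (2 * K)"]) (use K(1) c0 main in \<open>auto simp: d_def E_def\<close>)
qed

theorem theorem1p4:
  fixes p :: real
  assumes "CARD('n::finite) \<ge> 2" and "1 < p"
  shows "\<forall>C1::real. C1 > 0 \<longrightarrow> (\<exists>C2::real. C2 > 0 \<and>
           (\<forall>(N::nat) (P :: (real ^ 'n) set).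
              N \<ge> 1 \<and> P \<subseteq> cbox 0 1 \<and> finite P \<and> card P = N \<and>
              Lp_norm_cube p (discrepancy P) \<le> C1 * ln (real N) powr ((real CARD('n) - 1) / 2)
              \<longrightarrow> Lp_norm_cube 1 (discrepancy P) \<ge> C2 * ln (real N) powr ((real CARD('n) - 1) / 2)))"
proof (intro allI impI)
  fix C1 :: real assume C1: "C1 > 0"
  define d where "d = CARD('n)"
  define E where "E = (real d - 1) / 2"
  \<comment> \<open>The cost of passing from \<open>n div d + 1\<close> to
    \<open>d * (n div d + 1)\<close>, which is at least \<open>n\<close>.\<close>
  define D where "D = real d powr E"
  have D: "0 < D" by (simp add: D_def d_def)
  have E: "0 < E" using assms(1) by (simp add: E_def d_def)
  obtain c where c: "0 < c"
    "\<And>(P :: (real ^ 'n) set) n. \<lbrakk>finite P; 2 * card P \<le> 2 ^ n; 2 ^ n \<le> 4 * card P;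
       (\<integral>x. \<bar>disc P x\<bar> powr p \<partial>cubeM) \<le> (C1 * D) powr p * (real (n div d + 1) powr E) powr p\<rbrakk>
      \<Longrightarrow> c * real (n div d + 1) powr E \<le> (\<integral>x. \<bar>disc P x\<bar> \<partial>cubeM)"
    using disc_L1_lower_bound[where 'n = 'n and p = p and Cp = "(C1 * D) powr p"] assms C1 D
    unfolding d_def E_def by auto
  show "\<exists>C2::real. C2 > 0 \<and>
           (\<forall>(N::nat) (P :: (real ^ 'n) set).
              N \<ge> 1 \<and> P \<subseteq> cbox 0 1 \<and> finite P \<and> card P = N \<and>
              Lp_norm_cube p (discrepancy P) \<le> C1 * ln (real N) powr ((real CARD('n) - 1) / 2)
              \<longrightarrow> Lp_norm_cube 1 (discrepancy P) \<ge> C2 * ln (real N) powr ((real CARD('n) - 1) / 2))"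
    unfolding d_def[symmetric] E_def[symmetric]
  proof (intro exI[of _ "c / D"] conjI allI impI)
    show "c / D > 0" using c(1) D by simp
    fix N :: nat and P :: "(real ^ 'n) set"
    assume A: "N \<ge> 1 \<and> P \<subseteq> cbox 0 1 \<and> finite P \<and> card P = N \<and>
              Lp_norm_cube p (discrepancy P) \<le> C1 * ln (real N) powr E"
    obtain k where k: "2 ^ k \<le> N" "N < 2 ^ (k + 1)"
      using ex_power_ivl1[of 2 N] A by auto
    \<comment> \<open>From \<open>2 ^ k \<le> N < 2 ^ (k + 1)\<close>, the shift by 2 gives
      \<open>2 * N < 2 ^ n\<close> and \<open>2 ^ n \<le> 4 * N\<close>.\<close>
    define n where "n = k + 2"
    have n: "2 * card P \<le> 2 ^ n" "2 ^ n \<le> 4 * card P"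
      using k A by (auto simp: n_def)
    define s where "s = real (n div d + 1) powr E"
    have s: "0 < s" by (simp add: s_def)
    \<comment> \<open>The bound of \<open>ln N\<close> by a multiple of \<open>n div d + 1\<close>
      serves twice in the same direction: it relaxes the hypothesis on the \<open>p\<close>-norm to
      one in terms of \<open>s\<close>, and it turns the lower bound \<open>c * s\<close> into one
      by the logarithm.\<close>
    have "ln (real N) \<le> real n"
    proof -
      have "N \<le> 2 ^ n" using n A by linarith
      hence "real N \<le> 2 ^ n" by (metis of_nat_le_iff of_nat_numeral of_nat_power)
      hence "ln (real N) \<le> ln (2 ^ n)" using A by (intro ln_mono) auto
      also have "\<dots> = real n * ln 2" by (simp add: ln_realpow)
      also have "\<dots> \<le> real n * 1" using ln_2_less_1 by (intro mult_left_mono) auto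
      finally show ?thesis by simp
    qed
    also have "real n \<le> real d * real (n div d + 1)"
    proof -
      have "n \<le> d * (n div d + 1)"
      proof -
        have "n mod d < d" by (simp add: d_def)
        thus ?thesis using mult_div_mod_eq[of d n] by (simp only: distrib_left mult_1_right)
      qed
      thus ?thesis by (metis of_nat_le_iff of_nat_mult)
    qed
    finally have "ln (real N) powr E \<le> (real d * real (n div d + 1)) powr E"
      using A E by (intro powr_mono2) auto
    hence ln_le: "ln (real N) powr E \<le> D * s" by (simp add: powr_mult D_def s_def)
    define I where "I = (\<integral>x. \<bar>disc P x\<bar> powr p \<partial>cubeM)"
    have I: "0 \<le> I" unfolding I_def by (intro integral_nonneg_AE) auto
    have "I powr (1 / p) \<le> C1 * ln (real N) powr E"
      using A Lp_norm_cube_discrepancy[of P p] by (simp add: I_def)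
    also have "\<dots> \<le> C1 * (D * s)" using ln_le C1 by (intro mult_left_mono) auto
    finally have "(I powr (1 / p)) powr p \<le> (C1 * D * s) powr p"
      using assms(2) by (intro powr_mono2) (auto simp: mult.assoc)
    hence "I \<le> (C1 * D) powr p * s powr p"
      using assms(2) I C1 D s by (simp add: powr_powr powr_mult)
    hence "c * s \<le> (\<integral>x. \<bar>disc P x\<bar> \<partial>cubeM)"
      using c(2)[of P n] A n unfolding I_def s_def by blast
    also have "\<dots> = Lp_norm_cube 1 (discrepancy P)"
      using A by (subst Lp_norm_cube_discrepancy) auto
    finally have *: "c * s \<le> Lp_norm_cube 1 (discrepancy P)" .
    have "c / D * ln (real N) powr E \<le> c / D * (D * s)"
      using ln_le c(1) D by (intro mult_left_mono) auto
    also have "\<dots> = c * s" using D by simp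
    finally show "Lp_norm_cube 1 (discrepancy P) \<ge> c / D * ln (real N) powr E"
      using * by linarith
  qed
qed

end
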